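(* Let $r$ be an integer and $0<t<r-1$. Let $\phi$ be an $(r-1)$-regular scaling function, $K(x,y)=\sum_{k\in\mathbb Z}\phi(x-k)\phi(y-k)$, and $K_j(f)(y)=\int_{\mathbb R}2^jK(2^jy,2^jx)f(x)\,dx$. Then the set $$\mathcal N_t=\{f\in\mathcal C^t(\mathbb R):\ \text{there do not exist } b_1>0 \text{ and } j_0\in\mathbb N \text{ such that } \|K_j(f)-f\|_\infty\ge b_12^{-jt}\ \text{for all } j\ge j_0\}$$ is nowhere dense in (the norm topology of) the Banach space $\mathcal C^t(\mathbb R)$.
   Context: A scaling function $\phi$ of a multiresolution analysis of $L^2(\mathbb R)$ (orthonormal integer translates) is $s$-regular if it is $s$ times weakly differentiable and, for $0\le\alpha\le s$, $|D^\alpha\phi(x)|\le c_1\lambda^{c_2|x|}$ for almost every $x\in\mathbb R$, some $c_1,c_2>0$ and some $0<\lambda<1$. For $0<t<s$, with $\phi$ $s$-regular and $\psi$ the associated mother wavelet, put $\alpha_k(f)=\int f(x)\phi(x-k)\,dx$ and $\beta_{lk}(f)=\int f(x)2^{l/2}\psi(2^lx-k)\,dx$. The Hölder–Zygmund space $\mathcal C^t(\mathbb R)$ is the set of bounded continuous functions $f:\mathbb R\to\mathbb R$ with $$\|f\|_{t,\infty}=\sup_{k\in\mathbb Z}|\alpha_k(f)|+\sup_{l\ge0}\sup_{k\in\mathbb Z}2^{l(t+1/2)}|\beta_{lk}(f)|<\infty,$$ normed by $\|\cdot\|_{t,\infty}$; any wavelet basis of regularity $s>t$ gives the same space with an equivalent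 norm. $\|\cdot\|_\infty$ is the supremum norm on $\mathbb R$; $j$ ranges over nonnegative integers. A set is nowhere dense if the interior of its closure is empty. *)

theory Defs
  imports "HOL-Analysis.Analysis"
begin

text \<open>
  Elements of \<open>L\<^sup>2(\<real>)\<close> are represented by square-integrable functions rather than by classes modulo
  null sets.  A set of functions that is \<open>l2_closed_subspace\<close> is automatically saturated under
  almost-everywhere equality, because \<open>l2_dist\<close> does not see null sets.
\<close>

definition L2 :: "(real \<Rightarrow> real) set" where
  "L2 = {f. f \<in> borel_measurable lebesgue \<and> integrable lebesgue (\<lambda>x. (f x)\<^sup>2)}"

definition l2_inner :: "(real \<Rightarrow> real) \<Rightarrow> (real \<Rightarrow> real) \<Rightarrow> real" where
  "l2_inner f g = (LINT x|lebesgue. f x * g x)"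

definition l2_dist :: "(real \<Rightarrow> real) \<Rightarrow> (real \<Rightarrow> real) \<Rightarrow> real" where
  "l2_dist f g = sqrt (LINT x|lebesgue. (f x - g x)\<^sup>2)"

definition l2_closure :: "(real \<Rightarrow> real) set \<Rightarrow> (real \<Rightarrow> real) set" where
  "l2_closure A = {f \<in> L2. \<forall>e>0. \<exists>g\<in>A. l2_dist f g < e}"

definition l2_closed_subspace :: "(real \<Rightarrow> real) set \<Rightarrow> bool" where
  "l2_closed_subspace A \<longleftrightarrow>
     A \<subseteq> L2 \<and> (\<lambda>x. 0) \<in> A \<and>
     (\<forall>f\<in>A. \<forall>g\<in>A. (\<lambda>x. f x + g x) \<in> A) \<and>
     (\<forall>c. \<forall>f\<in>A. (\<lambda>x. c * f x) \<in> A) \<and>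
     l2_closure A \<subseteq> A"

definition l2_orthonormal_basis :: "(int \<Rightarrow> real \<Rightarrow> real) \<Rightarrow> (real \<Rightarrow> real) set \<Rightarrow> bool" where
  "l2_orthonormal_basis e A \<longleftrightarrow>
     (\<forall>k. e k \<in> A) \<and>
     (\<forall>k m. l2_inner (e k) (e m) = (if k = m then 1 else 0)) \<and>
     A \<subseteq> l2_closure {\<lambda>x. \<Sum>k\<in>F. c k * e k x |F c. finite F}"

definition multiresolution_analysis :: "(int \<Rightarrow> (real \<Rightarrow> real) set) \<Rightarrow> (real \<Rightarrow> real) \<Rightarrow> bool" where
  "multiresolution_analysis V \<phi> \<longleftrightarrow>
     (\<forall>j. l2_closed_subspace (V j)) \<and>
     (\<forall>j. V j \<subseteq> V (j + 1)) \<and>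
     (\<forall>j f. f \<in> V j \<longleftrightarrow> (\<lambda>x. f (2 * x)) \<in> V (j + 1)) \<and>
     l2_closure (\<Union>j. V j) = L2 \<and>
     (\<Inter>j. V j) = {f \<in> L2. AE x in lebesgue. f x = 0} \<and>
     l2_orthonormal_basis (\<lambda>k x. \<phi> (x - of_int k)) (V 0)"

text \<open>
  This determines \<open>\<psi>\<close> only up to a unitary 1-periodic Fourier multiplier, which need not preserve
  decay; coefficients of bounded functions make sense once \<open>\<psi>\<close> is also \<open>regular\<close> (below).
\<close>

definition mother_wavelet :: "(int \<Rightarrow> (real \<Rightarrow> real) set) \<Rightarrow> (real \<Rightarrow> real) \<Rightarrow> bool" where
  "mother_wavelet V \<psi> \<longleftrightarrow>
     l2_orthonormal_basis (\<lambda>k x. \<psi> (x - of_int k)) {f \<in> V 1. \<forall>g\<in>V 0. l2_inner f g = 0}"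

definition test_functions :: "(real \<Rightarrow> real) set" where
  "test_functions =
     {\<theta>. (\<forall>n x. (deriv ^^ n) \<theta> field_differentiable at x) \<and> bounded {x. \<theta> x \<noteq> 0}}"

definition locally_integrable :: "(real \<Rightarrow> real) \<Rightarrow> bool" where
  "locally_integrable f \<longleftrightarrow> (\<forall>C. compact C \<longrightarrow> set_integrable lebesgue C f)"

definition weak_derivative :: "nat \<Rightarrow> (real \<Rightarrow> real) \<Rightarrow> (real \<Rightarrow> real) \<Rightarrow> bool" where
  "weak_derivative n f g \<longleftrightarrow>
     locally_integrable f \<and> locally_integrable g \<and>
     (\<forall>\<theta>\<in>test_functions.
        (LINT x|lebesgue. f x * (deriv ^^ n) \<theta> x) = (-1) ^ n * (LINT x|lebesgue. g x * \<theta> x))"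

definition regular :: "nat \<Rightarrow> (real \<Rightarrow> real) \<Rightarrow> bool" where
  "regular s \<phi> \<longleftrightarrow>
     (\<exists>D c\<^sub>1 c\<^sub>2 q. D 0 = \<phi> \<and> c\<^sub>1 > 0 \<and> c\<^sub>2 > 0 \<and> 0 < q \<and> q < 1 \<and>
        (\<forall>\<alpha>\<le>s. weak_derivative \<alpha> \<phi> (D \<alpha>) \<and>
               (AE x in lebesgue. \<bar>D \<alpha> x\<bar> \<le> c\<^sub>1 * q powr (c\<^sub>2 * \<bar>x\<bar>))))"

text \<open>
  Below, \<open>\<phi>\<close> and \<open>\<psi>\<close> are only constrained almost everywhere, so integrals are taken over \<open>lebesgue\<close> and no
  continuous representative is chosen.  For regular \<open>\<phi>\<close> the series in \<open>proj_kernel\<close> converges absolutely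
  for almost every \<open>x\<close> and \<open>y\<close>.
\<close>

definition scaling_coeff :: "(real \<Rightarrow> real) \<Rightarrow> int \<Rightarrow> (real \<Rightarrow> real) \<Rightarrow> real" where
  "scaling_coeff \<phi> k f = (LINT x|lebesgue. f x * \<phi> (x - of_int k))"

definition wavelet_coeff :: "(real \<Rightarrow> real) \<Rightarrow> nat \<Rightarrow> int \<Rightarrow> (real \<Rightarrow> real) \<Rightarrow> real" where
  "wavelet_coeff \<psi> l k f =
     (LINT x|lebesgue. f x * (2 powr (real l / 2) * \<psi> (2 ^ l * x - of_int k)))"

text \<open>
  Norms are extended-real valued, so that an infinite supremum is \<open>\<infinity>\<close> and not an unspecified real.
\<close>

definition hz_norm :: "(real \<Rightarrow> real) \<Rightarrow> (real \<Rightarrow> real) \<Rightarrow> real \<Rightarrow> (real \<Rightarrow> real) \<Rightarrow> ereal" where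
  "hz_norm \<phi> \<psi> t f =
     (SUP k. ereal \<bar>scaling_coeff \<phi> k f\<bar>) +
     (SUP l. SUP k. ereal (2 powr (real l * (t + 1/2)) * \<bar>wavelet_coeff \<psi> l k f\<bar>))"

definition hz_space :: "(real \<Rightarrow> real) \<Rightarrow> (real \<Rightarrow> real) \<Rightarrow> real \<Rightarrow> (real \<Rightarrow> real) set" where
  "hz_space \<phi> \<psi> t =
     {f. continuous_on UNIV f \<and> bounded (range f) \<and> hz_norm \<phi> \<psi> t f < \<infinity>}"

definition hz_topology :: "(real \<Rightarrow> real) \<Rightarrow> (real \<Rightarrow> real) \<Rightarrow> real \<Rightarrow> (real \<Rightarrow> real) topology" where
  "hz_topology \<phi> \<psi> t = topology_generated_by
     {{g \<in> hz_space \<phi> \<psi> t. hz_norm \<phi> \<psi> t (\<lambda>x. g x - f x) < ereal e} |f e.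
        f \<in> hz_space \<phi> \<psi> t \<and> e > 0}"

definition sup_norm :: "(real \<Rightarrow> real) \<Rightarrow> ereal" where
  "sup_norm f = (SUP x. ereal \<bar>f x\<bar>)"

definition proj_kernel :: "(real \<Rightarrow> real) \<Rightarrow> real \<Rightarrow> real \<Rightarrow> real" where
  "proj_kernel \<phi> x y = (\<Sum>\<^sub>\<infinity>k::int. \<phi> (x - of_int k) * \<phi> (y - of_int k))"

definition proj :: "(real \<Rightarrow> real) \<Rightarrow> nat \<Rightarrow> (real \<Rightarrow> real) \<Rightarrow> real \<Rightarrow> real" where
  "proj \<phi> j f y = (LINT x|lebesgue. 2 ^ j * proj_kernel \<phi> (2 ^ j * y) (2 ^ j * x) * f x)"

definition nowhere_dense_in :: "'a topology \<Rightarrow> 'a set \<Rightarrow> bool" where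
  "nowhere_dense_in X S \<longleftrightarrow> X interior_of (X closure_of S) = {}"

end

theory Submission
  imports Defs
begin

text \<open>
  The projection of \<open>f\<close> at level \<open>j\<close> carries no detail of that level: \<open>K\<^sub>j f\<close> lies in the
  span of the \<open>\<phi>(2\<^sup>j x - k)\<close>, which is orthogonal to \<open>\<psi>\<^bsub>j,0\<^esub>\<close>.  Hence \<open>\<beta>\<^bsub>j,0\<^esub>(f)\<close> is the integral of
  \<open>(f - K\<^sub>j f) \<psi>\<^bsub>j,0\<^esub>\<close>, and
  \<open>2\<^bsup>j/2\<^esup> |\<beta>\<^bsub>j,0\<^esub>(f)| \<le> \<parallel>K\<^sub>j f - f\<parallel>\<^sub>\<infinity> \<parallel>\<psi>\<parallel>\<^sub>1\<close>.
  So \<open>f\<close> is approximated at the slowest possible rate \<open>2\<^bsup>-jt\<^esup>\<close> as soon as the normalised coefficients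
  \<open>2\<^bsup>j(t+1/2)\<^esup> |\<beta>\<^bsub>j,0\<^esub>(f)|\<close> are bounded below by some \<open>d > 0\<close>.  The norm of \<open>\<C>\<^sup>t\<close> dominates each
  normalised coefficient, so this condition persists, with a smaller \<open>d\<close>, on a ball around \<open>f\<close>.

  It remains to find such functions near any given \<open>f\<close>.  Let \<open>h\<close> be the lacunary series
  \<open>\<Sum> \<sigma>\<^sub>m 2\<^bsup>-mt\<^esup> \<psi>(2\<^sup>m x)\<close> with signs \<open>\<sigma>\<^sub>m\<close>.  By orthogonality its only nonzero coefficients are
  those with \<open>k = 0\<close>, and their normalised values are exactly the \<open>\<sigma>\<^sub>m\<close>; in particular \<open>h\<close> has norm 1.
  If \<open>\<sigma>\<^sub>m\<close> is the sign of \<open>\<beta>\<^bsub>m,0\<^esub>(f)\<close>, nothing cancels in \<open>f + (e/2) h\<close>, and all its normalised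
  coefficients at \<open>k = 0\<close> have modulus at least \<open>e/2\<close>.  Every ball therefore contains a ball that avoids
  the set in question (\<open>hz_ball_contains_slow_ball\<close>), which makes that set nowhere dense.

  Two points need analysis.  The elements of \<open>\<C>\<^sup>t\<close> are continuous while \<open>\<psi>\<close> is given only almost
  everywhere, so \<open>h\<close> has to be built from a bounded continuous representative of \<open>\<psi>\<close>.  It exists because
  \<open>t < r - 1\<close> forces at least one bounded weak derivative (\<open>continuous_representative\<close>).  And \<open>f\<close> is
  bounded but need not be square integrable, so the orthogonality of \<open>K\<^sub>j f\<close> and \<open>\<psi>\<^bsub>j,0\<^esub>\<close> has to be obtained by
  exchanging sums and integrals, which the exponential decay of \<open>\<phi>\<close> allows
  (\<open>orthogonal_integral_le_approximation_error\<close>).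
\<close>

section \<open>A supply of test functions\<close>

text \<open>
  The exponent \<open>k\<close> makes the family closed under differentiation up to linear combinations:
  \<open>flat k\<close> has derivative \<open>flat (k + 2) - k flat (k + 1)\<close>.
\<close>

definition flat :: "nat \<Rightarrow> real \<Rightarrow> real" where
  "flat k x = (if x > 0 then exp (- (1 / x)) / x ^ k else 0)"

text \<open>
  Smoothness is obtained without any formula for higher derivatives: this class consists of
  differentiable functions and is closed under taking derivatives, since each rule below is matched by
  a differentiation rule whose result is again built by these rules.
\<close>

inductive_set smooth_functions :: "(real \<Rightarrow> real) set" where
  flat: "flat k \<in> smooth_functions"
| const: "(\<lambda>x. c) \<in> smooth_functions"
| ident: "(\<lambda>x. x) \<in> smooth_functions"
| add: "f \<in> smooth_functions \<Longrightarrow> g \<in> smooth_functions \<Longrightarrow> (\<lambda>x. f x + g x) \<in> smooth_functions"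
| mult: "f \<in> smooth_functions \<Longrightarrow> g \<in> smooth_functions \<Longrightarrow> (\<lambda>x. f x * g x) \<in> smooth_functions"
| inverse: "f \<in> smooth_functions \<Longrightarrow> (\<And>x. f x \<noteq> 0) \<Longrightarrow> (\<lambda>x. inverse (f x)) \<in> smooth_functions"
| affine: "f \<in> smooth_functions \<Longrightarrow> (\<lambda>x. f (a * x + b)) \<in> smooth_functions"

text \<open>
  This is the difference quotient at \<open>0\<close>; the substitution \<open>y = 1 / x\<close> turns it into \<open>y\<^bsup>k+1\<^esup> / exp y\<close>.
\<close>

lemma flat_over_x_tendsto: "((\<lambda>x. flat k x / x) \<longlongrightarrow> 0) (at 0)"
proof -
  have "((\<lambda>y::real. y ^ Suc k / exp y) \<longlongrightarrow> 0) at_top"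
    by (rule tendsto_power_div_exp_0)
  then have "((\<lambda>x::real. inverse x ^ Suc k / exp (inverse x)) \<longlongrightarrow> 0) (at_right 0)"
    by (rule filterlim_compose[OF _ filterlim_inverse_at_top_right])
  moreover have "\<forall>\<^sub>F x in at_right 0. inverse x ^ Suc k / exp (inverse x) = flat k x / x"
    unfolding eventually_at_right_field
    by (intro exI[of _ 1]) (auto simp: flat_def field_simps exp_minus)
  ultimately have "((\<lambda>x. flat k x / x) \<longlongrightarrow> 0) (at_right 0)"
    by (rule Lim_transform_eventually)
  moreover have "((\<lambda>x. flat k x / x) \<longlongrightarrow> 0) (at_left 0)"
    by (rule tendsto_eventually) (auto simp: flat_def eventually_at_left_field intro: exI[of _ "-1"])
  ultimately show ?thesis
    by (simp add: filterlim_at_split)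
qed

lemma flat_has_field_derivative:
  "(flat k has_field_derivative flat (k + 2) x - real k * flat (k + 1) x) (at x)"
proof -
  consider "x > 0" | "x < 0" | "x = 0" by linarith
  then show ?thesis
  proof cases
    case 1
    have "((\<lambda>x. exp (- (1 / x)) / x ^ k) has_field_derivative
        flat (k + 2) x - real k * flat (k + 1) x) (at x)"
    proof (rule DERIV_cong)
      show "((\<lambda>x. exp (- (1 / x)) / x ^ k) has_field_derivative
          (exp (- (1 / x)) * (1 / x\<^sup>2) * x ^ k - exp (- (1 / x)) * (real k * x ^ (k - 1))) / (x ^ k * x ^ k)) (at x)"
        using 1 by (auto intro!: derivative_eq_intros simp: power2_eq_square)
      show "(exp (- (1 / x)) * (1 / x\<^sup>2) * x ^ k - exp (- (1 / x)) * (real k * x ^ (k - 1))) / (x ^ k * x ^ k)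
          = flat (k + 2) x - real k * flat (k + 1) x"
        using 1 by (cases k) (simp_all add: flat_def field_simps power2_eq_square)
    qed
    then show ?thesis
      by (rule has_field_derivative_transform_within_open[of _ _ _ "{0<..}"])
        (use 1 in \<open>auto simp: flat_def\<close>)
  next
    case 2
    have "((\<lambda>x. 0) has_field_derivative flat (k + 2) x - real k * flat (k + 1) x) (at x)"
      using 2 by (simp add: flat_def)
    then show ?thesis
      by (rule has_field_derivative_transform_within_open[of _ _ _ "{..<0}"])
        (use 2 in \<open>auto simp: flat_def\<close>)
  next
    case 3
    have "((\<lambda>x. (flat k x - flat k 0) / (x - 0)) \<longlongrightarrow> 0) (at 0)"
      using flat_over_x_tendsto[of k] by (simp add: flat_def)
    then show ?thesis
      using 3 by (simp add: has_field_derivative_iff) (simp add: flat_def)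
  qed
qed

lemma smooth_functions_derivative:
  assumes "f \<in> smooth_functions"
  shows "\<exists>f'\<in>smooth_functions. \<forall>x. (f has_field_derivative f' x) (at x)"
  using assms
proof induction
  case (flat k)
  have "(\<lambda>x. flat (k + 2) x + (- real k) * flat (k + 1) x) \<in> smooth_functions"
    by (intro smooth_functions.intros)
  then show ?case
    using flat_has_field_derivative[of k] by (force intro: bexI[rotated])
next
  case (const c)
  show ?case
    by (intro bexI[of _ "\<lambda>x. 0"] smooth_functions.intros) auto
next
  case ident
  show ?case
    by (intro bexI[of _ "\<lambda>x. 1"] smooth_functions.intros) auto
next
  case (add f g)
  then obtain f' g' where "f' \<in> smooth_functions" "g' \<in> smooth_functions"
    "\<And>x. (f has_field_derivative f' x) (at x)" "\<And>x. (g has_field_derivative g' x) (at x)"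
    by blast
  then show ?case
    by (intro bexI[of _ "\<lambda>x. f' x + g' x"] smooth_functions.intros)
      (auto intro!: derivative_eq_intros)
next
  case (mult f g)
  then obtain f' g' where "f' \<in> smooth_functions" "g' \<in> smooth_functions"
    "\<And>x. (f has_field_derivative f' x) (at x)" "\<And>x. (g has_field_derivative g' x) (at x)"
    by blast
  then show ?case
    using mult.hyps by (intro bexI[of _ "\<lambda>x. f' x * g x + f x * g' x"] smooth_functions.intros)
      (auto intro!: derivative_eq_intros)
next
  case (inverse f)
  then obtain f' where "f' \<in> smooth_functions" "\<And>x. (f has_field_derivative f' x) (at x)"
    by blast
  then show ?case
    using inverse.hyps
    by (intro bexI[of _ "\<lambda>x. (-1) * (f' x * (inverse (f x) * inverse (f x)))"] smooth_functions.intros)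
      (auto intro!: derivative_eq_intros simp: mult_ac)
next
  case (affine f a b)
  then obtain f' where f': "f' \<in> smooth_functions" "\<And>x. (f has_field_derivative f' x) (at x)"
    by blast
  have "((\<lambda>x. f (a * x + b)) has_field_derivative a * f' (a * x + b)) (at x)" for x
    by (rule DERIV_cong[OF DERIV_chain2[where g = "\<lambda>x. a * x + b" and Db = a, OF f'(2)]])
      (auto intro!: derivative_eq_intros)
  then show ?case
    using f' by (intro bexI[of _ "\<lambda>x. a * f' (a * x + b)"] smooth_functions.intros) auto
qed

lemma smooth_functions_deriv:
  assumes "f \<in> smooth_functions"
  shows "deriv f \<in> smooth_functions" "(f has_field_derivative deriv f x) (at x)"
proof -
  obtain f' where f': "f' \<in> smooth_functions" "\<And>x. (f has_field_derivative f' x) (at x)"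
    using smooth_functions_derivative[OF assms] by blast
  then have "deriv f = f'"
    by (auto simp: DERIV_imp_deriv)
  then show "deriv f \<in> smooth_functions" "(f has_field_derivative deriv f x) (at x)"
    using f' by auto
qed

lemma smooth_functions_continuous:
  assumes "f \<in> smooth_functions"
  shows "continuous_on UNIV f"
  by (rule continuous_at_imp_continuous_on) (use DERIV_isCont[OF smooth_functions_deriv(2)[OF assms]] in blast)

lemma smooth_functions_higher_deriv:
  assumes "f \<in> smooth_functions"
  shows "(deriv ^^ n) f \<in> smooth_functions"
  by (induction n) (auto intro: assms smooth_functions_deriv)

lemma smooth_functions_test_function:
  assumes "f \<in> smooth_functions" "bounded {x. f x \<noteq> 0}"
  shows "f \<in> test_functions"
  using assms smooth_functions_deriv(2)[OF smooth_functions_higher_deriv[OF assms(1)]]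
  by (auto simp: test_functions_def field_differentiable_def)

text \<open>
  A smooth version of the positive part \<open>max 0 x\<close>, equal to it outside \<open>[0, 1]\<close>.  The second factor is
  the usual smooth step from \<open>0\<close> to \<open>1\<close>; multiplying the step by \<open>x\<close> avoids integrating it.
\<close>

definition smooth_ramp :: "real \<Rightarrow> real" where
  "smooth_ramp x = x * (flat 0 x * inverse (flat 0 x + flat 0 (1 - x)))"

lemma smooth_ramp_smooth: "smooth_ramp \<in> smooth_functions"
proof -
  have "(\<lambda>x. flat 0 ((-1) * x + 1)) \<in> smooth_functions"
    by (intro smooth_functions.intros)
  then have 1: "(\<lambda>x. flat 0 (1 - x)) \<in> smooth_functions" by simp
  have "flat 0 x + flat 0 (1 - x) \<noteq> 0" for x
  proof -
    have "flat 0 y \<ge> 0" "y > 0 \<Longrightarrow> flat 0 y > 0" for y by (auto simp: flat_def)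
    moreover have "x > 0 \<or> 1 - x > 0" by linarith
    ultimately show ?thesis by (smt (verit))
  qed
  with 1 have "(\<lambda>x. x * (flat 0 x * inverse (flat 0 x + flat 0 (1 - x)))) \<in> smooth_functions"
    by (intro smooth_functions.intros)
  then show ?thesis by (simp add: smooth_ramp_def[abs_def])
qed

lemma smooth_ramp_eq:
  "x \<le> 0 \<Longrightarrow> smooth_ramp x = 0" "x \<ge> 1 \<Longrightarrow> smooth_ramp x = x"
  by (auto simp: smooth_ramp_def flat_def)

lemma smooth_ramp_near: "\<bar>smooth_ramp x - max 0 x\<bar> \<le> 1"
proof -
  consider "x \<le> 0" | "x \<ge> 1" | "0 < x" "x < 1" by linarith
  then show ?thesis
  proof cases
    case 3
    have p: "flat 0 x > 0" "flat 0 (1 - x) > 0" using 3 by (auto simp: flat_def)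
    define q where "q = flat 0 x * inverse (flat 0 x + flat 0 (1 - x))"
    have "0 \<le> q" "q \<le> 1" using p by (auto simp: q_def field_simps)
    then have "0 \<le> x * q" "x * q \<le> 1"
      using 3 mult_mono[of x 1 q 1] by auto
    then show ?thesis using 3 by (auto simp: smooth_ramp_def q_def[symmetric] abs_le_iff)
  qed (auto simp: smooth_ramp_eq)
qed

lemma deriv_smooth_ramp:
  "x < 0 \<Longrightarrow> deriv smooth_ramp x = 0" "x > 1 \<Longrightarrow> deriv smooth_ramp x = 1"
proof -
  assume x: "x < 0"
  have "((\<lambda>x. 0) has_field_derivative 0) (at x)" by simp
  then have "(smooth_ramp has_field_derivative 0) (at x)"
    by (rule has_field_derivative_transform_within_open[of _ _ _ "{..<0}"])
      (use x in \<open>auto simp: smooth_ramp_eq\<close>)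
  then show "deriv smooth_ramp x = 0" by (rule DERIV_imp_deriv)
next
  assume x: "x > 1"
  have "((\<lambda>x. x) has_field_derivative 1) (at x)" by simp
  then have "(smooth_ramp has_field_derivative 1) (at x)"
    by (rule has_field_derivative_transform_within_open[of _ _ _ "{1<..}"])
      (use x in \<open>auto simp: smooth_ramp_eq\<close>)
  then show "deriv smooth_ramp x = 1" by (rule DERIV_imp_deriv)
qed

lemma deriv_smooth_ramp_bounded: "\<exists>M. \<forall>x. \<bar>deriv smooth_ramp x\<bar> \<le> M"
proof -
  have "continuous_on UNIV (deriv smooth_ramp)"
    by (intro smooth_functions_continuous smooth_functions_deriv(1) smooth_ramp_smooth)
  then have "compact (deriv smooth_ramp ` {0..1})"
    by (intro compact_continuous_image) (auto intro: continuous_on_subset)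
  then have "bounded (deriv smooth_ramp ` {0..1})"
    by (rule compact_imp_bounded)
  then obtain M where "\<forall>y\<in>deriv smooth_ramp ` {0..1}. norm y \<le> M"
    by (auto simp only: bounded_iff)
  then have M: "\<bar>deriv smooth_ramp x\<bar> \<le> M" if "x \<in> {0..1}" for x
    using that by auto
  have "\<bar>deriv smooth_ramp x\<bar> \<le> max 1 M" for x
    using M[of x] deriv_smooth_ramp[of x] by (cases "x < 0"; cases "x > 1") (auto simp: max_def)
  then show ?thesis by blast
qed

text \<open>
  Without the smoothing, this is the primitive of the difference of the indicators of \<open>[c, c + h]\<close> and
  \<open>[d, d + h]\<close>; for \<open>c + h \<le> d\<close> it rises to height \<open>h\<close>, stays there, and falls back to \<open>0\<close>.  The
  parameter \<open>m\<close> is the sharpness of the four corners.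
\<close>

definition trapezoid :: "real \<Rightarrow> real \<Rightarrow> real \<Rightarrow> real \<Rightarrow> real \<Rightarrow> real" where
  "trapezoid m c d h y = (smooth_ramp (m * (y - c)) - smooth_ramp (m * (y - (c + h)))
     - smooth_ramp (m * (y - d)) + smooth_ramp (m * (y - (d + h)))) / m"

lemma trapezoid_smooth: "trapezoid m c d h \<in> smooth_functions"
proof -
  define R where "R p y = smooth_ramp (m * (y - p))" for p y
  have r: "R p \<in> smooth_functions" for p
    using smooth_functions.affine[OF smooth_ramp_smooth, of m "- (m * p)"]
    by (simp add: R_def[abs_def] right_diff_distrib)
  have "(\<lambda>y. ((R c y + (-1) * R (c + h) y) + ((-1) * R d y + R (d + h) y)) * inverse m) \<in> smooth_functions"
    by (intro smooth_functions.add smooth_functions.mult smooth_functions.const r)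
  also have "(\<lambda>y. ((R c y + (-1) * R (c + h) y) + ((-1) * R d y + R (d + h) y)) * inverse m)
      = trapezoid m c d h"
    by (rule ext) (simp add: R_def trapezoid_def divide_inverse)
  finally show ?thesis .
qed

lemma trapezoid_derivative:
  assumes "m > 0"
  shows "deriv (trapezoid m c d h) y = deriv smooth_ramp (m * (y - c)) - deriv smooth_ramp (m * (y - (c + h)))
     - deriv smooth_ramp (m * (y - d)) + deriv smooth_ramp (m * (y - (d + h)))"
proof (rule DERIV_imp_deriv)
  have r: "((\<lambda>y. smooth_ramp (m * (y - p))) has_field_derivative deriv smooth_ramp (m * (y - p)) * m) (at y)" for p
    by (rule DERIV_chain2[OF smooth_functions_deriv(2)[OF smooth_ramp_smooth]])
      (auto intro!: derivative_eq_intros)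
  show "(trapezoid m c d h has_real_derivative
     deriv smooth_ramp (m * (y - c)) - deriv smooth_ramp (m * (y - (c + h)))
     - deriv smooth_ramp (m * (y - d)) + deriv smooth_ramp (m * (y - (d + h)))) (at y)"
    unfolding trapezoid_def[abs_def]
    by (rule DERIV_cong[OF DERIV_cdivide[OF DERIV_add[OF DERIV_diff[OF DERIV_diff[OF r r] r] r]]])
      (use assms in \<open>simp add: field_simps\<close>)
qed

text \<open>
  To the right of all four corners the ramps are affine, and their contributions cancel because the two
  plateaus that make up the derivative have the same length.
\<close>

lemma trapezoid_support:
  assumes "m > 0" "h \<ge> 0" "c \<le> d" "y \<notin> {c..d + h + 1 / m}"
  shows "trapezoid m c d h y = 0"
proof (cases "y < c")
  case True
  then have "m * (y - p) \<le> 0" if "p \<ge> c" for p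
    using assms that by (auto simp: mult_le_0_iff)
  then show ?thesis using assms by (simp add: trapezoid_def smooth_ramp_eq)
next
  case False
  then have y: "y > d + h + 1 / m" using assms by auto
  have "m * (y - p) \<ge> 1" if "p \<le> d + h" for p
  proof -
    have "1 / m \<le> y - p" using y that by auto
    then show ?thesis using assms by (simp add: field_simps)
  qed
  then have "trapezoid m c d h y = (m * (y - c) - m * (y - (c + h)) - m * (y - d) + m * (y - (d + h))) / m"
    using assms by (simp add: trapezoid_def smooth_ramp_eq)
  then show ?thesis by (simp add: algebra_simps)
qed

lemma trapezoid_bound:
  assumes "m > 0" "h \<ge> 0" "c \<le> d"
  shows "\<bar>trapezoid m c d h y\<bar> \<le> (h + 4 / m) * indicator {c..d + h + 1 / m} y"
proof -
  have r: "\<bar>smooth_ramp (m * (y - p)) / m - max 0 (y - p)\<bar> \<le> 1 / m" for p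
  proof -
    have "max 0 (y - p) = max 0 (m * (y - p)) / m"
      using assms(1) by (simp add: max_divide_distrib_right)
    then have "\<bar>smooth_ramp (m * (y - p)) / m - max 0 (y - p)\<bar> = \<bar>smooth_ramp (m * (y - p)) - max 0 (m * (y - p))\<bar> / m"
      using assms(1) by (simp add: diff_divide_distrib[symmetric])
    also have "\<dots> \<le> 1 / m"
      using assms(1) smooth_ramp_near by (intro divide_right_mono) auto
    finally show ?thesis .
  qed
  have "trapezoid m c d h y = smooth_ramp (m * (y - c)) / m - smooth_ramp (m * (y - (c + h))) / m
     - smooth_ramp (m * (y - d)) / m + smooth_ramp (m * (y - (d + h))) / m"
    by (simp add: trapezoid_def diff_divide_distrib add_divide_distrib)
  moreover have "\<bar>max 0 (y - c) - max 0 (y - (c + h)) - max 0 (y - d) + max 0 (y - (d + h))\<bar> \<le> h"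
    using assms by (auto simp: max_def)
  ultimately have "\<bar>trapezoid m c d h y\<bar> \<le> h + 4 / m"
    using r[of c] r[of "c + h"] r[of d] r[of "d + h"] unfolding abs_le_iff minus_diff_eq
    by (elim conjE, intro conjI) linarith+
  then show ?thesis
    using trapezoid_support[OF assms, of y] by (auto simp: indicator_def)
qed

lemma deriv_trapezoid_tendsto:
  assumes "h > 0" "y \<notin> {c, c + h, d, d + h}"
  shows "(\<lambda>n. deriv (trapezoid (real (Suc n)) c d h) y)
    \<longlonglongrightarrow> indicator {c..c + h} y - indicator {d..d + h} y"
proof -
  have r: "(\<lambda>n. deriv smooth_ramp (real (Suc n) * (y - p))) \<longlonglongrightarrow> (if y > p then 1 else 0)"
    if "y \<noteq> p" for p
  proof (rule tendsto_eventually, cases "y > p")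
    case True
    obtain N :: nat where N: "real N > 1 / (y - p)" using reals_Archimedean2 by blast
    have "deriv smooth_ramp (real (Suc n) * (y - p)) = 1" if "n \<ge> N" for n
    proof (rule deriv_smooth_ramp(2))
      have "1 / (y - p) < real (Suc n)" using N that by linarith
      then show "1 < real (Suc n) * (y - p)" using True by (simp add: field_simps)
    qed
    then show "\<forall>\<^sub>F n in sequentially. deriv smooth_ramp (real (Suc n) * (y - p)) = (if y > p then 1 else 0)"
      using True by (auto simp: eventually_sequentially)
  next
    case False
    then have "real (Suc n) * (y - p) < 0" for n
      using that by (intro mult_pos_neg) auto
    then show "\<forall>\<^sub>F n in sequentially. deriv smooth_ramp (real (Suc n) * (y - p)) = (if y > p then 1 else 0)"
      using False by (simp add: deriv_smooth_ramp)
  qed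
  have eq: "indicator {c..c + h} y - indicator {d..d + h} y =
    (if y > c then 1 else 0) - (if y > c + h then 1 else 0) - (if y > d then 1 else 0) + (if y > d + h then 1 else (0::real))"
    using assms by (auto simp: indicator_def)
  show ?thesis
    unfolding eq trapezoid_derivative[OF of_nat_0_less_iff[THEN iffD2, OF zero_less_Suc]]
    using assms(2) by (intro tendsto_intros r) auto
qed

section \<open>Continuous representatives of functions with a bounded weak derivative\<close>

lemma AE_lebesgue_neq: "AE x in lebesgue. x \<noteq> (a::real)"
  by (intro AE_completion AE_lborel_singleton)

text \<open>
  Testing the weak derivative against sharper and sharper trapezoids: their derivatives tend boundedly
  to the difference of the indicators of the two intervals, while the trapezoids themselves are
  bounded by \<open>h\<close> and supported in \<open>[c, d + h]\<close> up to errors that vanish in the limit.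
\<close>

lemma weak_derivative_averages:
  assumes int: "integrable lebesgue f"
    and wd: "weak_derivative 1 f g" and g: "AE x in lebesgue. \<bar>g x\<bar> \<le> L" and "L \<ge> 0"
    and "c \<le> d" "h > 0"
  shows "\<bar>integral {c..c + h} f - integral {d..d + h} f\<bar> \<le> L * h * (d - c + h)"
proof -
  obtain M where M: "\<And>x. \<bar>deriv smooth_ramp x\<bar> \<le> M"
    using deriv_smooth_ramp_bounded by blast
  let ?T = "\<lambda>n. trapezoid (real (Suc n)) c d h"
  have meas: "deriv (?T n) \<in> borel_measurable lebesgue" for n
  proof -
    have "continuous_on UNIV (deriv (?T n))"
      by (intro smooth_functions_continuous smooth_functions_deriv(1) trapezoid_smooth)
    then have "deriv (?T n) \<in> borel_measurable borel"
      by (rule borel_measurable_continuous_onI)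
    then show ?thesis by (simp add: measurable_completion)
  qed
  have seti: "set_integrable lebesgue {a..b} f" for a b
    unfolding set_integrable_def using int by (intro integrable_mult_indicator) auto
  have "(\<lambda>n. LINT x|lebesgue. f x * deriv (?T n) x)
      \<longlonglongrightarrow> (LINT x|lebesgue. f x * (indicator {c..c + h} x - indicator {d..d + h} x))"
  proof (rule integral_dominated_convergence[where w = "\<lambda>x. 4 * M * \<bar>f x\<bar>"])
    show "integrable lebesgue (\<lambda>x. 4 * M * \<bar>f x\<bar>)" using int by auto
    show "(\<lambda>x. f x * (indicator {c..c + h} x - indicator {d..d + h} x)) \<in> borel_measurable lebesgue"
      using int by (intro borel_measurable_times borel_measurable_diff borel_measurable_indicator) auto
    show "(\<lambda>x. f x * deriv (?T n) x) \<in> borel_measurable lebesgue" for n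
      using int meas by (intro borel_measurable_times) auto
    show "AE x in lebesgue. norm (f x * deriv (?T n) x) \<le> 4 * M * \<bar>f x\<bar>" for n
    proof (rule AE_I2)
      fix x
      have "\<bar>deriv (?T n) x\<bar> \<le> 4 * M"
        using M unfolding trapezoid_derivative[OF of_nat_0_less_iff[THEN iffD2, OF zero_less_Suc]]
        by (smt (verit, ccfv_SIG))
      then have "\<bar>f x\<bar> * \<bar>deriv (?T n) x\<bar> \<le> \<bar>f x\<bar> * (4 * M)"
        by (intro mult_left_mono) auto
      then show "norm (f x * deriv (?T n) x) \<le> 4 * M * \<bar>f x\<bar>"
        by (simp add: abs_mult mult_ac)
    qed
    show "AE x in lebesgue. (\<lambda>n. f x * deriv (?T n) x) \<longlonglongrightarrow> f x * (indicator {c..c + h} x - indicator {d..d + h} x)"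
      using AE_lebesgue_neq[of c] AE_lebesgue_neq[of "c + h"] AE_lebesgue_neq[of d] AE_lebesgue_neq[of "d + h"]
    proof eventually_elim
      case (elim x)
      then show ?case
        using deriv_trapezoid_tendsto[of h x c d] \<open>h > 0\<close> by (intro tendsto_mult tendsto_const) auto
    qed
  qed
  also have "(LINT x|lebesgue. f x * (indicator {c..c + h} x - indicator {d..d + h} x))
      = integral {c..c + h} f - integral {d..d + h} f"
  proof -
    have "(LINT x|lebesgue. f x * (indicator {c..c + h} x - indicator {d..d + h} x))
       = (LINT x:{c..c + h}|lebesgue. f x) - (LINT x:{d..d + h}|lebesgue. f x)"
      using seti unfolding set_lebesgue_integral_def set_integrable_def
      by (subst Bochner_Integration.integral_diff[symmetric]) (auto simp: algebra_simps)
    then show ?thesis by (simp add: set_lebesgue_integral_eq_integral[OF seti])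
  qed
  finally have lim: "(\<lambda>n. \<bar>LINT x|lebesgue. f x * deriv (?T n) x\<bar>)
      \<longlonglongrightarrow> \<bar>integral {c..c + h} f - integral {d..d + h} f\<bar>"
    by (rule tendsto_rabs)
  have bound: "\<bar>LINT x|lebesgue. f x * deriv (?T n) x\<bar>
      \<le> L * ((h + 4 / real (Suc n)) * (d + h + 1 / real (Suc n) - c))" for n
  proof -
    let ?m = "real (Suc n)"
    have m: "?m > 0" by simp
    let ?I = "{c..d + h + 1 / ?m}"
    have nn: "0 \<le> 1 / ?m" by simp
    have le: "c \<le> d + h + 1 / ?m" using \<open>c \<le> d\<close> \<open>h > 0\<close> nn by linarith
    have "bounded {y. ?T n y \<noteq> 0}"
    proof (rule bounded_subset)
      show "{y. ?T n y \<noteq> 0} \<subseteq> ?I"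
        using trapezoid_support[OF m less_imp_le[OF \<open>h > 0\<close>] \<open>c \<le> d\<close>] by blast
    qed simp
    then have "?T n \<in> test_functions"
      by (intro smooth_functions_test_function trapezoid_smooth)
    then have "(LINT x|lebesgue. f x * deriv (?T n) x) = - (LINT x|lebesgue. g x * ?T n x)"
      using wd by (auto simp: weak_derivative_def)
    then have "\<bar>LINT x|lebesgue. f x * deriv (?T n) x\<bar> = norm (LINT x|lebesgue. g x * ?T n x)"
      by simp
    also have "\<dots> \<le> (LINT x|lebesgue. norm (g x * ?T n x))"
      by (rule integral_norm_bound)
    also have "\<dots> \<le> (LINT x|lebesgue. L * ((h + 4 / ?m) * indicator ?I x))"
    proof (rule integral_mono_AE')
      show "integrable lebesgue (\<lambda>x. L * ((h + 4 / ?m) * indicator ?I x))"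
        by (intro integrable_mult_right integrable_real_indicator)
          (auto simp: emeasure_lborel_Icc_eq)
      show "AE x in lebesgue. norm (g x * ?T n x) \<le> L * ((h + 4 / ?m) * indicator ?I x)"
        using g
      proof eventually_elim
        case (elim x)
        then show ?case
          using trapezoid_bound[OF m, of h c d x] \<open>c \<le> d\<close> \<open>h > 0\<close> \<open>L \<ge> 0\<close>
          by (auto simp: abs_mult intro!: mult_mono)
      qed
    qed (use \<open>L \<ge> 0\<close> \<open>h > 0\<close> in auto)
    also have "\<dots> = L * ((h + 4 / ?m) * (d + h + 1 / ?m - c))"
      using le by simp
    finally show ?thesis .
  qed
  have z: "(\<lambda>n. k / real (Suc n)) \<longlonglongrightarrow> 0" for k :: real
    using tendsto_mult[OF tendsto_const[of k] LIMSEQ_inverse_real_of_nat] by (simp add: field_simps)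
  have lim': "(\<lambda>n. L * ((h + 4 / real (Suc n)) * (d + h + 1 / real (Suc n) - c)))
      \<longlonglongrightarrow> L * ((h + 0) * (d + h + 0 - c))"
    by (intro tendsto_intros z)
  have "\<bar>integral {c..c + h} f - integral {d..d + h} f\<bar> \<le> L * ((h + 0) * (d + h + 0 - c))"
    by (rule LIMSEQ_le[OF lim lim']) (use bound in blast)
  then show ?thesis by (simp add: algebra_simps)
qed

text \<open>
  Dividing the preceding estimate by \<open>h\<close> and letting \<open>h\<close> tend to \<open>0\<close> shows that \<open>f\<close> is Lipschitz on the
  set of points where its averages converge to its value.  This set has full measure, so it is dense, and
  the restriction of \<open>f\<close> to it extends continuously to the whole line.
\<close>

lemma continuous_representative:
  assumes int: "integrable lebesgue f"
    and wd: "weak_derivative 1 f g" and g: "AE x in lebesgue. \<bar>g x\<bar> \<le> L"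
    and f: "AE x in lebesgue. \<bar>f x\<bar> \<le> B"
  obtains u where "continuous_on UNIV u" "\<And>x. \<bar>u x\<bar> \<le> B" "AE x in lebesgue. u x = f x"
proof -
  define L' where "L' = max L 0"
  have L': "L' \<ge> 0" "AE x in lebesgue. \<bar>g x\<bar> \<le> L'"
    using g by (auto simp: L'_def elim: eventually_mono)
  have "f integrable_on cbox a b" for a b
  proof -
    have "set_integrable lebesgue {a..b} f"
      unfolding set_integrable_def using int by (intro integrable_mult_indicator) auto
    then show ?thesis using set_lebesgue_integral_eq_integral(1) by fastforce
  qed
  then obtain N1 where N1: "negligible N1" and avg:
    "\<And>x e. x \<notin> N1 \<Longrightarrow> 0 < e \<Longrightarrow> \<exists>d>0. \<forall>h. 0 < h \<and> h < d \<longrightarrow>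
        norm (integral (cbox x (x + h *\<^sub>R One)) f /\<^sub>R h ^ DIM(real) - f x) < e"
    using integrable_ccontinuous_explicit[of f] by metis
  have lim: "((\<lambda>h. integral {x..x + h} f / h) \<longlongrightarrow> f x) (at_right 0)" if "x \<notin> N1" for x
    unfolding tendsto_iff eventually_at_right_field
  proof (intro allI impI)
    fix e :: real assume "e > 0"
    from avg[OF that this] obtain d where "d > 0"
      "\<forall>h. 0 < h \<and> h < d \<longrightarrow> norm (integral (cbox x (x + h *\<^sub>R One)) f /\<^sub>R h ^ DIM(real) - f x) < e"
      by blast
    then show "\<exists>b>0. \<forall>y>0. y < b \<longrightarrow> dist (integral {x..x + y} f / y) (f x) < e"
      by (intro exI[of _ d]) (auto simp: dist_real_def field_simps)
  qed
  obtain N2 where N2: "negligible N2" "{x. \<not> \<bar>f x\<bar> \<le> B} \<subseteq> N2"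
    using f unfolding eventually_ae_filter_negligible by blast
  define N where "N = N1 \<union> N2"
  have N: "negligible N" using N1 N2 by (auto simp: N_def)
  have lip: "\<bar>f c - f d\<bar> \<le> L' * (d - c)" if "c \<le> d" "c \<notin> N" "d \<notin> N" for c d
  proof -
    have 1: "((\<lambda>h. \<bar>integral {c..c + h} f / h - integral {d..d + h} f / h\<bar>) \<longlongrightarrow> \<bar>f c - f d\<bar>) (at_right 0)"
      using that by (intro tendsto_intros lim) (auto simp: N_def)
    have 2: "((\<lambda>h. L' * (d - c + h)) \<longlongrightarrow> L' * (d - c + 0)) (at_right 0)"
      by (intro tendsto_intros)
    have "\<bar>integral {c..c + h} f / h - integral {d..d + h} f / h\<bar> \<le> L' * (d - c + h)" if "h > 0" for h
    proof -
      have "\<bar>integral {c..c + h} f / h - integral {d..d + h} f / h\<bar>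
          = \<bar>integral {c..c + h} f - integral {d..d + h} f\<bar> / h"
        using that by (simp add: diff_divide_distrib[symmetric])
      also have "\<dots> \<le> (L' * h * (d - c + h)) / h"
        using weak_derivative_averages[OF int wd L'(2) L'(1) \<open>c \<le> d\<close> that] that
        by (intro divide_right_mono) auto
      finally show ?thesis using that by simp
    qed
    then have 3: "\<forall>\<^sub>F h in at_right 0. \<bar>integral {c..c + h} f / h - integral {d..d + h} f / h\<bar> \<le> L' * (d - c + h)"
      by (auto simp: eventually_at_right_field intro: exI[of _ 1])
    from tendsto_le[OF _ 2 1 3] show ?thesis by simp
  qed
  have lip': "dist (f c) (f d) \<le> L' * dist c d" if "c \<notin> N" "d \<notin> N" for c d
    using lip[of c d] lip[of d c] that by (cases "c \<le> d") (auto simp: dist_real_def abs_minus_commute)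
  have "uniformly_continuous_on (- N) f"
    by (rule lipschitz_on_uniformly_continuous[of L']) (use lip' L' in \<open>auto simp: lipschitz_on_def\<close>)
  then obtain u where u: "uniformly_continuous_on (closure (- N)) u" "\<And>x. x \<in> - N \<Longrightarrow> f x = u x"
    using uniformly_continuous_on_extension_on_closure by metis
  have cl: "closure (- N) = UNIV"
  proof -
    have "interior N = {}"
      using N by (meson negligible_subset interior_subset open_interior open_not_negligible)
    then show ?thesis by (simp add: closure_complement)
  qed
  have cont: "continuous_on UNIV u"
    using u(1) cl uniformly_continuous_imp_continuous by metis
  have "u ` closure (- N) \<subseteq> closure (u ` (- N))"
    by (intro image_closure_subset closed_closure closure_subset continuous_on_subset[OF cont]) auto
  also have "\<dots> \<subseteq> cball 0 B"
  proof (intro closure_minimal subsetI)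
    fix z assume "z \<in> u ` (- N)"
    then obtain x where x: "x \<notin> N" "z = u x" by auto
    then have "x \<notin> N2" by (simp add: N_def)
    then have "\<bar>f x\<bar> \<le> B" using N2(2) by blast
    moreover have "u x = f x" using u(2)[of x] x by simp
    ultimately show "z \<in> cball 0 B" using x by simp
  qed simp
  finally have "\<bar>u x\<bar> \<le> B" for x using cl by (auto simp: image_subset_iff)
  moreover have "AE x in lebesgue. u x = f x"
    unfolding eventually_ae_filter_negligible by (rule exI[of _ N]) (use u(2) N in force)
  ultimately show thesis using cont that by blast
qed


section \<open>Integrability and summability from exponential decay\<close>

lemma AE_lebesgue_affine:
  fixes P :: "real \<Rightarrow> bool"
  assumes "AE x in lebesgue. P x" "c \<noteq> 0"
  shows "AE x in lebesgue. P (t + c * x)"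
proof -
  have "AE x in lborel. P x"
    using assms(1) by (simp add: AE_completion_iff)
  then obtain N where N: "{x. \<not> P x} \<subseteq> N" "N \<in> null_sets lborel"
    unfolding eventually_ae_filter by auto
  then have "AE x in lborel. x \<notin> N"
    by (intro AE_not_in)
  then have "AE x in lborel. t + c * x \<notin> N"
    using N(2) \<open>c \<noteq> 0\<close> by (intro AE_borel_affine[of c "\<lambda>x. x \<notin> N"]) (auto simp: null_sets_def)
  then have "AE x in lborel. P (t + c * x)"
    by (rule eventually_mono) (use N(1) in blast)
  then show ?thesis
    by (rule AE_completion)
qed

lemma integrable_lebesgue_exp_abs:
  fixes b :: real
  assumes "b > 0"
  shows "integrable lebesgue (\<lambda>x. exp (- (b * \<bar>x\<bar>)))"
proof -
  let ?h = "\<lambda>x::real. indicator {0..} x * exp (- b * x)"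
  have "(\<lambda>x. exp (- b * x)) absolutely_integrable_on {0..}"
    using integrable_on_exp_minus_to_infinity[OF assms] by (intro nonnegative_absolutely_integrable_1) auto
  then have 1: "integrable lebesgue ?h"
    by (simp add: set_integrable_def)
  have "integrable lebesgue (\<lambda>x. ?h x + ?h (0 + (-1) * x))"
    by (intro Bochner_Integration.integrable_add 1 lebesgue_integrable_real_affine[OF 1]) simp
  then show ?thesis
  proof (rule Bochner_Integration.integrable_bound)
    show "(\<lambda>x. exp (- (b * \<bar>x\<bar>))) \<in> borel_measurable lebesgue"
      by (intro measurable_completion) measurable
    show "AE x in lebesgue. norm (exp (- (b * \<bar>x\<bar>))) \<le> norm (?h x + ?h (0 + (-1) * x))"
      by (auto simp: indicator_def)
  qed
qed

lemma sum_power_abs_int_le: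
  fixes a :: real
  assumes "0 < a" "a < 1" "finite G"
  shows "(\<Sum>k\<in>G. a ^ nat \<bar>k\<bar>) \<le> 2 / (1 - a)"
proof -
  have half: "(\<Sum>k\<in>H. a ^ nat \<bar>k\<bar>) \<le> 1 / (1 - a)"
    if "finite H" "inj_on (\<lambda>k. nat \<bar>k\<bar>) H" for H :: "int set"
  proof -
    have "(\<Sum>k\<in>H. a ^ nat \<bar>k\<bar>) = (\<Sum>i\<in>(\<lambda>k. nat \<bar>k\<bar>) ` H. a ^ i)"
      using that by (simp add: sum.reindex)
    also have "\<dots> \<le> (\<Sum>i. a ^ i)"
      using assms that by (intro sum_le_suminf) (auto intro: summable_geometric)
    finally show ?thesis using assms by (simp add: suminf_geometric)
  qed
  have "(\<Sum>k\<in>G. a ^ nat \<bar>k\<bar>) = (\<Sum>k\<in>G \<inter> {0..}. a ^ nat \<bar>k\<bar>) + (\<Sum>k\<in>G \<inter> {..<0}. a ^ nat \<bar>k\<bar>)"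
    using assms(3) by (subst sum.union_disjoint[symmetric]) (auto intro!: sum.cong)
  also have "\<dots> \<le> 1 / (1 - a) + 1 / (1 - a)"
    using assms(3) by (intro add_mono half) (auto simp: inj_on_def)
  finally show ?thesis by simp
qed

lemma exponential_decay_integrable:
  fixes f :: "real \<Rightarrow> real"
  assumes meas: "f \<in> borel_measurable lebesgue"
    and "0 < q" "q < 1" "b > 0"
    and bound: "AE x in lebesgue. \<bar>f x\<bar> \<le> c * q powr (b * \<bar>x\<bar>)"
  shows "integrable lebesgue f"
proof -
  have "- (b * ln q) > 0"
    using assms mult_pos_neg[of b "ln q"] by simp
  then have "integrable lebesgue (\<lambda>x. c * exp (- (- (b * ln q) * \<bar>x\<bar>)))"
    by (intro integrable_mult_right integrable_lebesgue_exp_abs)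
  then show ?thesis
    by (rule Bochner_Integration.integrable_bound[OF _ meas])
      (use bound in eventually_elim, use \<open>0 < q\<close> in \<open>simp add: powr_def mult_ac\<close>)
qed

text \<open>
  With \<open>n\<close> the integer part of \<open>x\<close>, \<open>|x - m|\<close> is at least \<open>|m - n| - 1\<close>, so the sum is compared with a
  two-sided geometric series that is independent of \<open>x\<close>.  Bounding all finite subsums at once gives
  absolute convergence together with a dominating constant.
\<close>

lemma exponential_decay_periodization:
  fixes f :: "real \<Rightarrow> real"
  assumes "0 < q" "q < 1" "b > 0" "c > 0"
    and bound: "AE x in lebesgue. \<bar>f x\<bar> \<le> c * q powr (b * \<bar>x\<bar>)"
  obtains C where "AE x in lebesgue. \<forall>F::int set. finite F \<longrightarrow> (\<Sum>m\<in>F. \<bar>f (x - of_int m)\<bar>) \<le> C"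
proof -
  define a where "a = q powr b"
  have a: "0 < a" "a < 1"
    using assms powr_less_mono2[of b q 1] by (auto simp: a_def)
  have pw: "a powr (real n - 1) = a ^ n / a" for n
    using a by (simp add: powr_diff powr_realpow)
  have "AE x in lebesgue. \<forall>m::int. \<bar>f (x - of_int m)\<bar> \<le> c * q powr (b * \<bar>x - of_int m\<bar>)"
    unfolding AE_all_countable
    using AE_lebesgue_affine[OF bound, of 1 "- of_int m" for m] by simp
  then have "AE x in lebesgue. \<forall>F::int set. finite F \<longrightarrow> (\<Sum>m\<in>F. \<bar>f (x - of_int m)\<bar>) \<le> c / a * (2 / (1 - a))"
  proof (rule eventually_mono, intro allI impI)
    fix x and F :: "int set"
    assume *: "\<forall>m::int. \<bar>f (x - of_int m)\<bar> \<le> c * q powr (b * \<bar>x - of_int m\<bar>)" and F: "finite F"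
    have "\<bar>f (x - of_int m)\<bar> \<le> c / a * a ^ nat \<bar>m - \<lfloor>x\<rfloor>\<bar>" for m :: int
    proof -
      have "real_of_int \<bar>m - \<lfloor>x\<rfloor>\<bar> - 1 \<le> \<bar>x - of_int m\<bar>"
        by linarith
      then have "q powr (b * \<bar>x - of_int m\<bar>) \<le> q powr (b * (real_of_int \<bar>m - \<lfloor>x\<rfloor>\<bar> - 1))"
        using assms by (intro powr_mono') auto
      also have "\<dots> = a powr (real (nat \<bar>m - \<lfloor>x\<rfloor>\<bar>) - 1)"
        by (simp add: a_def powr_powr)
      also have "\<dots> = a ^ nat \<bar>m - \<lfloor>x\<rfloor>\<bar> / a"
        by (rule pw)
      finally have "c * q powr (b * \<bar>x - of_int m\<bar>) \<le> c * (a ^ nat \<bar>m - \<lfloor>x\<rfloor>\<bar> / a)"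
        using \<open>c > 0\<close> by (intro mult_left_mono) auto
      then show ?thesis
        using *[rule_format, of m] by simp
    qed
    then have "(\<Sum>m\<in>F. \<bar>f (x - of_int m)\<bar>) \<le> (\<Sum>m\<in>F. c / a * a ^ nat \<bar>m - \<lfloor>x\<rfloor>\<bar>)"
      by (rule sum_mono)
    also have "\<dots> = c / a * (\<Sum>k\<in>(\<lambda>m. m - \<lfloor>x\<rfloor>) ` F. a ^ nat \<bar>k\<bar>)"
      by (simp add: sum_distrib_left sum.reindex inj_on_def)
    also have "\<dots> \<le> c / a * (2 / (1 - a))"
      using a \<open>c > 0\<close> F by (intro mult_left_mono sum_power_abs_int_le) auto
    finally show "(\<Sum>m\<in>F. \<bar>f (x - of_int m)\<bar>) \<le> c / a * (2 / (1 - a))" .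
  qed
  then show thesis by (rule that)
qed

text \<open>
  The bijection \<open>int_decode\<close> turns sums over the integers into series, for which the theorems on
  exchanging limits and integrals are stated.
\<close>

lemma int_sum_bound_summable:
  fixes p :: "int \<Rightarrow> real"
  assumes "\<forall>F. finite F \<longrightarrow> (\<Sum>m\<in>F. \<bar>p m\<bar>) \<le> C"
  shows "(\<Sum>i<n. \<bar>p (int_decode i)\<bar>) \<le> C" "summable (\<lambda>i. \<bar>p (int_decode i)\<bar>)" "\<bar>p m\<bar> \<le> C"
proof -
  have inj: "inj_on int_decode A" for A
    by (meson bij_int_decode bij_is_inj inj_on_subset subset_UNIV)
  show *: "(\<Sum>i<n. \<bar>p (int_decode i)\<bar>) \<le> C" for n
    using assms[rule_format, of "int_decode ` {..<n}"] inj by (simp add: sum.reindex)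
  show "summable (\<lambda>i. \<bar>p (int_decode i)\<bar>)"
    by (rule summableI_nonneg_bounded[OF _ *]) auto
  show "\<bar>p m\<bar> \<le> C"
    using assms[rule_format, of "{m}"] by simp
qed

lemma infsum_int_eq_suminf:
  fixes p :: "int \<Rightarrow> real"
  assumes "summable (\<lambda>i. \<bar>p (int_decode i)\<bar>)"
  shows "infsum p UNIV = (\<Sum>i. p (int_decode i))"
proof -
  have "((\<lambda>i. p (int_decode i)) has_sum (\<Sum>i. p (int_decode i))) UNIV"
    using assms by (intro norm_summable_imp_has_sum summable_sums[OF summable_rabs_cancel]) auto
  then show ?thesis
    using infsum_reindex_bij_betw[OF bij_int_decode, of p] infsumI by metis
qed

lemma integrable_lebesgue_shift:
  fixes f :: "real \<Rightarrow> real"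
  assumes "integrable lebesgue f"
  shows "integrable lebesgue (\<lambda>x. f (x - a))"
  using lebesgue_integrable_real_affine[OF assms, of 1 "- a"] by simp

lemma integrable_mult_AE_bounded:
  fixes f g :: "real \<Rightarrow> real"
  assumes "integrable lebesgue f" "g \<in> borel_measurable lebesgue" "AE x in lebesgue. \<bar>g x\<bar> \<le> A"
  shows "integrable lebesgue (\<lambda>x. f x * g x)"
proof (rule Bochner_Integration.integrable_bound)
  show "integrable lebesgue (\<lambda>x. A * f x)" using assms(1) by simp
  show "AE x in lebesgue. norm (f x * g x) \<le> norm (A * f x)"
    using assms(3)
  proof eventually_elim
    case (elim x)
    have "\<bar>f x\<bar> * \<bar>g x\<bar> \<le> \<bar>f x\<bar> * \<bar>A\<bar>"
      using elim by (intro mult_left_mono) auto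
    then show ?case by (simp add: abs_mult mult.commute)
  qed
qed (use assms in auto)

section \<open>The projection error dominates the wavelet coefficients\<close>

text \<open>
  For almost every \<open>y\<close>, the series that defines the kernel may be integrated term by term against \<open>f\<close>:
  the \<open>L\<^sup>1\<close> norms of the terms are at most a constant times the summable \<open>|\<phi>(y - m)|\<close>.
\<close>

lemma proj_kernel_integral_expansion:
  fixes \<phi> f :: "real \<Rightarrow> real"
  assumes \<phi>: "integrable lebesgue \<phi>"
    and C: "AE x in lebesgue. \<forall>F::int set. finite F \<longrightarrow> (\<Sum>m\<in>F. \<bar>\<phi> (x - of_int m)\<bar>) \<le> C"
    and f: "f \<in> borel_measurable lebesgue" "\<And>x. \<bar>f x\<bar> \<le> A"
  shows "AE y in lebesgue. (LINT x|lebesgue. proj_kernel \<phi> y x * f x)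
      = (\<Sum>i. \<phi> (y - of_int (int_decode i)) * scaling_coeff \<phi> (int_decode i) f)"
  using C
proof eventually_elim
  fix y assume y: "\<forall>F::int set. finite F \<longrightarrow> (\<Sum>m\<in>F. \<bar>\<phi> (y - of_int m)\<bar>) \<le> C"
  define p where "p m = \<phi> (y - of_int m)" for m :: int
  note p = int_sum_bound_summable[of p, OF y[folded p_def]]
  let ?d = int_decode
  define s where "s i x = p (?d i) * (f x * \<phi> (x - of_int (?d i)))" for i x
  have int: "integrable lebesgue (\<lambda>x. f x * \<phi> (x - of_int m))" for m :: int
    using integrable_mult_AE_bounded[OF integrable_lebesgue_shift[OF \<phi>] f(1), of A] f(2)
    by (simp add: mult.commute)
  have s_int: "integrable lebesgue (s i)" for i
    unfolding s_def[abs_def] by (intro integrable_mult_right int)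
  have "AE x in lebesgue. summable (\<lambda>i. norm (s i x)) \<and> (\<Sum>i. s i x) = proj_kernel \<phi> y x * f x"
    using C
  proof eventually_elim
    fix x assume x: "\<forall>F::int set. finite F \<longrightarrow> (\<Sum>m\<in>F. \<bar>\<phi> (x - of_int m)\<bar>) \<le> C"
    have bx: "\<bar>\<phi> (x - of_int m)\<bar> \<le> C" for m :: int
      using int_sum_bound_summable(3)[OF x] .
    have sm: "summable (\<lambda>i. \<bar>p (?d i) * \<phi> (x - of_int (?d i))\<bar>)"
      by (rule summable_comparison_test'[OF summable_mult2[OF p(2), of C], of 0])
        (auto simp: abs_mult bx mult_left_mono)
    have "summable (\<lambda>i. norm (s i x))"
      using summable_mult2[OF sm, of "\<bar>f x\<bar>"] by (simp add: s_def abs_mult mult_ac)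
    moreover have "(\<Sum>i. s i x) = proj_kernel \<phi> y x * f x"
    proof -
      have "proj_kernel \<phi> y x = (\<Sum>i. p (?d i) * \<phi> (x - of_int (?d i)))"
        unfolding proj_kernel_def p_def[symmetric] using sm by (rule infsum_int_eq_suminf)
      then have "proj_kernel \<phi> y x * f x = (\<Sum>i. p (?d i) * \<phi> (x - of_int (?d i)) * f x)"
        using suminf_mult2[OF summable_rabs_cancel[OF sm], of "f x"] by simp
      then show ?thesis by (simp add: s_def mult_ac)
    qed
    ultimately show "summable (\<lambda>i. norm (s i x)) \<and> (\<Sum>i. s i x) = proj_kernel \<phi> y x * f x" ..
  qed
  then have ae1: "AE x in lebesgue. summable (\<lambda>i. norm (s i x))"
    and ae2: "AE x in lebesgue. (\<Sum>i. s i x) = proj_kernel \<phi> y x * f x"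
    by (eventually_elim, simp)+
  have sn: "summable (\<lambda>i. LINT x|lebesgue. norm (s i x))"
  proof (rule summable_comparison_test'[OF summable_mult2[OF p(2), of "A * (LINT x|lebesgue. \<bar>\<phi> x\<bar>)"], of 0])
    fix i :: nat
    have shift: "(LINT x|lebesgue. \<bar>\<phi> (x - of_int (?d i))\<bar>) = (LINT x|lebesgue. \<bar>\<phi> x\<bar>)"
      using lebesgue_integral_real_affine[of 1 "\<lambda>x. \<bar>\<phi> x\<bar>" "- of_int (?d i)"] by simp
    have "(LINT x|lebesgue. norm (s i x)) \<le> (LINT x|lebesgue. \<bar>p (?d i)\<bar> * (A * \<bar>\<phi> (x - of_int (?d i))\<bar>))"
    proof (rule integral_mono)
      show "integrable lebesgue (\<lambda>x. \<bar>p (?d i)\<bar> * (A * \<bar>\<phi> (x - of_int (?d i))\<bar>))"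
        using integrable_lebesgue_shift[OF \<phi>] by (intro integrable_mult_right integrable_abs)
      show "norm (s i x) \<le> \<bar>p (?d i)\<bar> * (A * \<bar>\<phi> (x - of_int (?d i))\<bar>)" for x
        unfolding s_def using f(2)[of x] by (auto simp: abs_mult intro!: mult_left_mono mult_right_mono)
    qed (use s_int in auto)
    then show "norm (LINT x|lebesgue. norm (s i x)) \<le> \<bar>p (?d i)\<bar> * (A * (LINT x|lebesgue. \<bar>\<phi> x\<bar>))"
      by (simp add: shift)
  qed
  have "(LINT x|lebesgue. proj_kernel \<phi> y x * f x) = (LINT x|lebesgue. (\<Sum>i. s i x))"
  proof (rule integral_cong_AE)
    show m: "(\<lambda>x. \<Sum>i. s i x) \<in> borel_measurable lebesgue"
      using s_int by (intro borel_measurable_suminf borel_measurable_integrable)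
    show "(\<lambda>x. proj_kernel \<phi> y x * f x) \<in> borel_measurable lebesgue"
      using m ae2 by (rule borel_measurable_AE)
    show "AE x in lebesgue. proj_kernel \<phi> y x * f x = (\<Sum>i. s i x)"
      using ae2 by eventually_elim simp
  qed
  also have "\<dots> = (\<Sum>i. LINT x|lebesgue. s i x)"
    by (rule integral_suminf[OF s_int ae1 sn])
  also have "\<dots> = (\<Sum>i. p (?d i) * scaling_coeff \<phi> (?d i) f)"
    by (simp add: s_def scaling_coeff_def)
  finally show "(LINT x|lebesgue. proj_kernel \<phi> y x * f x)
      = (\<Sum>i. \<phi> (y - of_int (int_decode i)) * scaling_coeff \<phi> (int_decode i) f)"
    by (simp add: p_def)
qed

lemma abs_scaling_coeff_le:
  assumes "integrable lebesgue \<phi>" "f \<in> borel_measurable lebesgue" "\<And>x. \<bar>f x\<bar> \<le> A"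
  shows "\<bar>scaling_coeff \<phi> k f\<bar> \<le> A * (LINT x|lebesgue. \<bar>\<phi> x\<bar>)"
proof -
  have "\<bar>scaling_coeff \<phi> k f\<bar> \<le> (LINT x|lebesgue. norm (f x * \<phi> (x - of_int k)))"
    unfolding scaling_coeff_def real_norm_def[symmetric] by (rule integral_norm_bound)
  also have "\<dots> \<le> (LINT x|lebesgue. A * \<bar>\<phi> (x - of_int k)\<bar>)"
  proof (rule integral_mono_AE')
    show "integrable lebesgue (\<lambda>x. A * \<bar>\<phi> (x - of_int k)\<bar>)"
      using integrable_lebesgue_shift[OF assms(1)] by (intro integrable_mult_right integrable_abs)
    have "A \<ge> 0" using assms(3)[of 0] by linarith
    then show "AE x in lebesgue. norm (f x * \<phi> (x - of_int k)) \<le> A * \<bar>\<phi> (x - of_int k)\<bar>"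
      "AE x in lebesgue. 0 \<le> A * \<bar>\<phi> (x - of_int k)\<bar>"
      using assms(3) by (auto simp: abs_mult mult_right_mono)
  qed
  also have "\<dots> = A * (LINT x|lebesgue. \<bar>\<phi> x\<bar>)"
    using lebesgue_integral_real_affine[of 1 "\<lambda>x. \<bar>\<phi> x\<bar>" "- of_int k"] by simp
  finally show ?thesis .
qed

text \<open>
  Although \<open>f\<close> need not be square integrable, its projection \<open>Q\<close> is a series in the translates of \<open>\<phi>\<close> with bounded
  coefficients.  Its partial sums are bounded uniformly, so \<open>Q \<psi>\<close> may be integrated term by
  term, which gives \<open>0\<close>.  Therefore the integral of \<open>f \<psi>\<close> equals that of \<open>(f - Q) \<psi>\<close>.
\<close>

lemma orthogonal_integral_le_approximation_error:
  fixes \<phi> \<psi> f :: "real \<Rightarrow> real"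
  assumes \<phi>: "integrable lebesgue \<phi>"
    and C: "AE x in lebesgue. \<forall>F::int set. finite F \<longrightarrow> (\<Sum>m\<in>F. \<bar>\<phi> (x - of_int m)\<bar>) \<le> C"
    and \<psi>: "integrable lebesgue \<psi>"
    and orth: "\<And>m::int. (LINT y|lebesgue. \<psi> y * \<phi> (y - of_int m)) = 0"
    and f: "f \<in> borel_measurable lebesgue" "\<And>x. \<bar>f x\<bar> \<le> A"
    and S: "\<And>y. \<bar>(LINT x|lebesgue. proj_kernel \<phi> y x * f x) - f y\<bar> \<le> S"
  shows "\<bar>LINT x|lebesgue. f x * \<psi> x\<bar> \<le> S * (LINT x|lebesgue. \<bar>\<psi> x\<bar>)"
proof -
  let ?d = int_decode
  define a where "a i = scaling_coeff \<phi> (?d i) f" for i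
  define A' where "A' = A * (LINT x|lebesgue. \<bar>\<phi> x\<bar>)"
  have a: "\<bar>a i\<bar> \<le> A'" for i
    unfolding a_def A'_def using \<phi> f by (rule abs_scaling_coeff_le)
  then have A': "A' \<ge> 0" using abs_ge_zero order_trans by blast
  define Q where "Q y = (\<Sum>i. \<phi> (y - of_int (?d i)) * a i)" for y
  have \<phi>m: "(\<lambda>y. \<phi> (y - of_int m)) \<in> borel_measurable lebesgue" for m :: int
    using integrable_lebesgue_shift[OF \<phi>] by (rule borel_measurable_integrable)
  have \<psi>m: "\<psi> \<in> borel_measurable lebesgue"
    using \<psi> by (rule borel_measurable_integrable)
  have Qm: "Q \<in> borel_measurable lebesgue"
    unfolding Q_def[abs_def] by (intro borel_measurable_suminf borel_measurable_times \<phi>m borel_measurable_const)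
  have \<phi>C: "AE y in lebesgue. \<bar>\<phi> (y - of_int m)\<bar> \<le> C" for m :: int
    using C by eventually_elim (rule int_sum_bound_summable(3))
  have int: "integrable lebesgue (\<lambda>y. \<psi> y * \<phi> (y - of_int m))" for m :: int
    by (rule integrable_mult_AE_bounded[OF \<psi> \<phi>m \<phi>C])
  let ?s = "\<lambda>n y. (\<Sum>i<n. a i * (\<psi> y * \<phi> (y - of_int (?d i))))"
  have partial: "AE y in lebesgue. (\<forall>n. \<bar>?s n y\<bar> \<le> C * A' * \<bar>\<psi> y\<bar>) \<and> (\<lambda>n. ?s n y) \<longlonglongrightarrow> Q y * \<psi> y"
    using C
  proof (eventually_elim, intro conjI allI)
    fix y n assume y: "\<forall>F::int set. finite F \<longrightarrow> (\<Sum>m\<in>F. \<bar>\<phi> (y - of_int m)\<bar>) \<le> C"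
    note p = int_sum_bound_summable[of "\<lambda>m. \<phi> (y - of_int m)", OF y]
    have "\<bar>?s n y\<bar> \<le> (\<Sum>i<n. \<bar>a i * (\<psi> y * \<phi> (y - of_int (?d i)))\<bar>)"
      by (rule sum_abs)
    also have "\<dots> \<le> (\<Sum>i<n. A' * (\<bar>\<psi> y\<bar> * \<bar>\<phi> (y - of_int (?d i))\<bar>))"
      using a A' by (intro sum_mono) (auto simp: abs_mult intro!: mult_mono)
    also have "\<dots> = A' * \<bar>\<psi> y\<bar> * (\<Sum>i<n. \<bar>\<phi> (y - of_int (?d i))\<bar>)"
      by (simp add: sum_distrib_left mult_ac)
    also have "\<dots> \<le> A' * \<bar>\<psi> y\<bar> * C"
      using p(1) A' by (intro mult_left_mono) auto
    finally show "\<bar>?s n y\<bar> \<le> C * A' * \<bar>\<psi> y\<bar>" by (simp add: mult_ac)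
    have "summable (\<lambda>i. \<bar>\<phi> (y - of_int (?d i)) * a i\<bar>)"
      by (rule summable_comparison_test'[OF summable_mult2[OF p(2), of A'], of 0])
        (auto simp: abs_mult a mult_left_mono)
    then have "(\<lambda>i. \<phi> (y - of_int (?d i)) * a i) sums Q y"
      unfolding Q_def by (rule summable_sums[OF summable_rabs_cancel])
    then have "(\<lambda>i. \<phi> (y - of_int (?d i)) * a i * \<psi> y) sums (Q y * \<psi> y)"
      by (rule sums_mult2)
    then show "(\<lambda>n. ?s n y) \<longlonglongrightarrow> Q y * \<psi> y"
      by (simp add: sums_def mult_ac)
  qed
  have sm: "?s n \<in> borel_measurable lebesgue" for n
    using int by (intro borel_measurable_integrable Bochner_Integration.integrable_sum integrable_mult_right)
  have w: "integrable lebesgue (\<lambda>y. C * A' * \<bar>\<psi> y\<bar>)"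
    using \<psi> by (intro integrable_mult_right integrable_abs)
  have lim: "AE y in lebesgue. (\<lambda>n. ?s n y) \<longlonglongrightarrow> Q y * \<psi> y"
    and dom: "AE y in lebesgue. norm (?s n y) \<le> C * A' * \<bar>\<psi> y\<bar>" for n
    using partial by (eventually_elim, simp)+
  have Q\<psi>m: "(\<lambda>y. Q y * \<psi> y) \<in> borel_measurable lebesgue"
    by (intro borel_measurable_times Qm \<psi>m)
  note dct = Q\<psi>m sm w lim dom
  have Q\<psi>: "integrable lebesgue (\<lambda>y. Q y * \<psi> y)"
    by (rule integrable_dominated_convergence[OF dct])
  have "(\<lambda>n. LINT y|lebesgue. ?s n y) \<longlonglongrightarrow> (LINT y|lebesgue. Q y * \<psi> y)"
    by (rule integral_dominated_convergence[OF dct])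
  moreover have "(LINT y|lebesgue. ?s n y) = 0" for n
    by (subst Bochner_Integration.integral_sum) (auto simp: int orth)
  ultimately have Q0: "(LINT y|lebesgue. Q y * \<psi> y) = 0"
    by (simp add: LIMSEQ_const_iff)
  have f\<psi>: "integrable lebesgue (\<lambda>y. f y * \<psi> y)"
    using integrable_mult_AE_bounded[OF \<psi> f(1), of A] f(2) by (simp add: mult.commute)
  have S0: "S \<ge> 0" using S[of 0] by linarith
  have "\<bar>LINT y|lebesgue. f y * \<psi> y\<bar> = norm (LINT y|lebesgue. f y * \<psi> y - Q y * \<psi> y)"
    using f\<psi> Q\<psi> Q0 by simp
  also have "\<dots> \<le> (LINT y|lebesgue. norm (f y * \<psi> y - Q y * \<psi> y))"
    by (rule integral_norm_bound)
  also have "\<dots> \<le> (LINT y|lebesgue. S * \<bar>\<psi> y\<bar>)"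
  proof (rule integral_mono_AE')
    show "integrable lebesgue (\<lambda>y. S * \<bar>\<psi> y\<bar>)"
      using \<psi> by (intro integrable_mult_right integrable_abs)
    show "AE y in lebesgue. norm (f y * \<psi> y - Q y * \<psi> y) \<le> S * \<bar>\<psi> y\<bar>"
      using proj_kernel_integral_expansion[OF \<phi> C f]
    proof eventually_elim
      case (elim y)
      have "\<bar>Q y - f y\<bar> \<le> S"
        using S[of y] unfolding elim Q_def a_def .
      then have "\<bar>f y - Q y\<bar> * \<bar>\<psi> y\<bar> \<le> S * \<bar>\<psi> y\<bar>"
        by (intro mult_right_mono) (auto simp: abs_minus_commute)
      then show ?case by (simp add: abs_mult[symmetric] left_diff_distrib)
    qed
  qed (use S0 in auto)
  finally show ?thesis by simp
qed


section \<open>Bounded continuous functions as integrands\<close>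

abbreviation bounded_continuous :: "(real \<Rightarrow> real) \<Rightarrow> bool" where
  "bounded_continuous f \<equiv> continuous_on UNIV f \<and> bounded (range f)"

lemma bounded_continuous_lebesgue:
  assumes "bounded_continuous f"
  obtains A where "f \<in> borel_measurable lebesgue" "\<And>x. \<bar>f x\<bar> \<le> A"
proof -
  have "f \<in> borel_measurable lebesgue"
    using assms by (intro measurable_completion) (auto intro: borel_measurable_continuous_onI)
  moreover obtain A where "\<And>x. \<bar>f x\<bar> \<le> A"
    using assms by (auto simp: bounded_iff)
  ultimately show thesis by (rule that)
qed

lemma bounded_continuous_add_mult:
  assumes "bounded_continuous f" "bounded_continuous g"
  shows "bounded_continuous (\<lambda>x. f x + c * g x)"
proof -
  obtain A where A: "\<And>x. \<bar>f x\<bar> \<le> A" using assms by (auto simp: bounded_iff)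
  obtain B where B: "\<And>x. \<bar>g x\<bar> \<le> B" using assms by (auto simp: bounded_iff)
  have "norm (f x + c * g x) \<le> A + \<bar>c\<bar> * B" for x
  proof -
    have "\<bar>f x + c * g x\<bar> \<le> \<bar>f x\<bar> + \<bar>c\<bar> * \<bar>g x\<bar>"
      by (metis abs_mult abs_triangle_ineq)
    also have "\<dots> \<le> A + \<bar>c\<bar> * B"
      using A[of x] B[of x] by (intro add_mono mult_left_mono) auto
    finally show ?thesis by simp
  qed
  then have "bounded (range (\<lambda>x. f x + c * g x))"
    by (intro boundedI[of _ "A + \<bar>c\<bar> * B"]) auto
  then show ?thesis
    using assms by (auto intro!: continuous_intros)
qed

lemma bounded_continuous_integrable_mult:
  assumes "bounded_continuous f" "integrable lebesgue w"
  shows "integrable lebesgue (\<lambda>x. f x * w x)"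
proof -
  obtain A where "f \<in> borel_measurable lebesgue" "\<And>x. \<bar>f x\<bar> \<le> A"
    using bounded_continuous_lebesgue[OF assms(1)] by blast
  then show ?thesis
    using integrable_mult_AE_bounded[OF assms(2), of f A] by (simp add: mult.commute)
qed

lemma bounded_continuous_integral_linear:
  assumes "bounded_continuous f" "bounded_continuous g" "integrable lebesgue w"
  shows "(LINT x|lebesgue. (f x + c * g x) * w x)
    = (LINT x|lebesgue. f x * w x) + c * (LINT x|lebesgue. g x * w x)"
proof -
  note i = bounded_continuous_integrable_mult[OF _ assms(3)]
  have "(LINT x|lebesgue. (f x + c * g x) * w x) = (LINT x|lebesgue. f x * w x + c * (g x * w x))"
    by (simp add: algebra_simps)
  also have "\<dots> = (LINT x|lebesgue. f x * w x) + c * (LINT x|lebesgue. g x * w x)"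
    using i[OF assms(1)] i[OF assms(2)] by simp
  finally show ?thesis .
qed

section \<open>Orthogonality of the wavelet system\<close>

lemma l2_inner_dilate:
  "l2_inner (\<lambda>x. f (2 * x)) (\<lambda>x. g (2 * x)) = l2_inner f g / 2"
  using lebesgue_integral_real_affine[of 2 "\<lambda>x. f x * g x" 0] by (simp add: l2_inner_def)

lemma l2_inner_commute: "l2_inner f g = l2_inner g f"
  by (simp add: l2_inner_def mult.commute)

lemma multiresolution_mono:
  assumes "multiresolution_analysis V \<phi>" "i \<le> j"
  shows "V i \<subseteq> V j"
  using assms(2)
proof (induction j rule: int_ge_induct)
  case (step j)
  moreover have "V j \<subseteq> V (j + 1)"
    using assms(1) by (simp add: multiresolution_analysis_def)
  ultimately show ?case by auto
qed simp

lemma scaling_function_in_V0: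
  assumes "multiresolution_analysis V \<phi>"
  shows "(\<lambda>x. \<phi> (x - of_int k)) \<in> V 0"
  using assms by (simp add: multiresolution_analysis_def l2_orthonormal_basis_def)

lemma mother_wavelet_in_W0:
  assumes "mother_wavelet V \<psi>"
  shows "(\<lambda>x. \<psi> (x - of_int k)) \<in> V 1"
    and "g \<in> V 0 \<Longrightarrow> l2_inner (\<lambda>x. \<psi> (x - of_int k)) g = 0"
  using assms by (simp_all add: mother_wavelet_def l2_orthonormal_basis_def)

lemma multiresolution_dilate:
  assumes "multiresolution_analysis V \<phi>"
  shows "f \<in> V j \<longleftrightarrow> (\<lambda>x. f (2 * x)) \<in> V (j + 1)"
  using assms by (simp add: multiresolution_analysis_def)

text \<open>
  Dilation by \<open>2\<close> maps \<open>V l\<close> onto \<open>V (l + 1)\<close> and halves inner products, so membership and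
  orthogonality propagate from level \<open>0\<close> to all levels.
\<close>

lemma wavelet_in_detail_space:
  assumes mra: "multiresolution_analysis V \<phi>" and mw: "mother_wavelet V \<psi>"
  shows "(\<lambda>x. \<psi> (2 ^ l * x - of_int k)) \<in> V (int l + 1) \<and>
    (\<forall>g\<in>V (int l). l2_inner (\<lambda>x. \<psi> (2 ^ l * x - of_int k)) g = 0)"
proof (induction l)
  case 0
  show ?case
    using mother_wavelet_in_W0[OF mw, where k = k] by simp
next
  case (Suc l)
  let ?w = "\<lambda>x. \<psi> (2 ^ l * x - of_int k)"
  have w: "(\<lambda>x. \<psi> (2 ^ Suc l * x - of_int k)) = (\<lambda>x. ?w (2 * x))"
    by (simp add: mult_ac)
  have "(\<lambda>x. ?w (2 * x)) \<in> V (int l + 1 + 1)"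
    using Suc.IH multiresolution_dilate[OF mra, of ?w "int l + 1"] by simp
  moreover have "l2_inner (\<lambda>x. ?w (2 * x)) g = 0" if "g \<in> V (int l + 1)" for g
  proof -
    let ?g = "\<lambda>x. g (x / 2)"
    have "?g \<in> V (int l)"
      using that multiresolution_dilate[OF mra, of ?g "int l"] by simp
    then have "l2_inner ?w ?g = 0" using Suc.IH by simp
    then show ?thesis
      using l2_inner_dilate[of ?w ?g] by simp
  qed
  ultimately show ?case unfolding w by (simp add: add.commute)
qed

lemma scaling_wavelet_orthogonal:
  assumes mra: "multiresolution_analysis V \<phi>" and mw: "mother_wavelet V \<psi>"
  shows "l2_inner (\<lambda>x. \<psi> (2 ^ l * x - of_int k)) (\<lambda>x. \<phi> (x - of_int m)) = 0"
proof -
  have "(\<lambda>x. \<phi> (x - of_int m)) \<in> V (int l)"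
    using scaling_function_in_V0[OF mra] multiresolution_mono[OF mra, of 0 "int l"] by auto
  then show ?thesis using wavelet_in_detail_space[OF mra mw, of l k] by simp
qed

lemma wavelets_orthogonal:
  assumes mra: "multiresolution_analysis V \<phi>" and mw: "mother_wavelet V \<psi>"
  shows "l2_inner (\<lambda>x. \<psi> (2 ^ m * x - of_int i)) (\<lambda>x. \<psi> (2 ^ l * x - of_int k))
    = (if m = l \<and> i = k then 1 / 2 ^ l else 0)"
proof -
  note d = wavelet_in_detail_space[OF mra mw]
  have less: "l2_inner (\<lambda>x. \<psi> (2 ^ b * x - of_int p)) (\<lambda>x. \<psi> (2 ^ a * x - of_int q)) = 0"
    if "a < b" for a b p q
  proof -
    have "V (int a + 1) \<subseteq> V (int b)"
      using that by (intro multiresolution_mono[OF mra]) auto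
    then show ?thesis using d[of a q] d[of b p] by auto
  qed
  consider "m < l" | "l < m" | "m = l" by linarith
  then show ?thesis
  proof cases
    case 1
    then show ?thesis using less[of m l k i] l2_inner_commute by auto
  next
    case 2
    then show ?thesis using less[of l m i k] by auto
  next
    case 3
    have "l2_inner (\<lambda>x. \<psi> (x - of_int i)) (\<lambda>x. \<psi> (x - of_int k)) = (if i = k then 1 else 0)"
      using mw by (simp add: mother_wavelet_def l2_orthonormal_basis_def)
    moreover have "l2_inner (\<lambda>x. \<psi> (x - of_int i)) (\<lambda>x. \<psi> (x - of_int k))
        = 2 ^ l * l2_inner (\<lambda>x. \<psi> (2 ^ l * x - of_int i)) (\<lambda>x. \<psi> (2 ^ l * x - of_int k))"
      using lebesgue_integral_real_affine[of "2 ^ l" "\<lambda>x. \<psi> (x - of_int i) * \<psi> (x - of_int k)" 0]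
      by (simp add: l2_inner_def)
    ultimately show ?thesis using 3 by (auto simp: field_simps)
  qed
qed

section \<open>Analysis and synthesis in one wavelet system\<close>

text \<open>
  What the argument uses of regularity: integrability of \<open>\<phi>\<close> and \<open>\<psi>\<close>, a bound for the periodization of
  \<open>|\<phi>|\<close>, and a bounded continuous representative \<open>u\<close> of \<open>\<psi>\<close>.
\<close>

locale wavelet_system =
  fixes V :: "int \<Rightarrow> (real \<Rightarrow> real) set" and \<phi> \<psi> u :: "real \<Rightarrow> real" and B C t :: real
  assumes mra: "multiresolution_analysis V \<phi>" and mw: "mother_wavelet V \<psi>"
    and \<phi>_integrable: "integrable lebesgue \<phi>" and \<psi>_integrable: "integrable lebesgue \<psi>"
    and \<phi>_periodization:
      "AE x in lebesgue. \<forall>F::int set. finite F \<longrightarrow> (\<Sum>m\<in>F. \<bar>\<phi> (x - of_int m)\<bar>) \<le> C"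
    and u_continuous: "continuous_on UNIV u" and u_bounded: "\<And>x. \<bar>u x\<bar> \<le> B"
    and u_\<psi>: "AE x in lebesgue. u x = \<psi> x"
    and t_pos: "0 < t"
begin

lemma wavelet_integrable:
  "integrable lebesgue (\<lambda>x. 2 powr (real l / 2) * \<psi> (2 ^ l * x - of_int k))"
  using lebesgue_integrable_real_affine[OF \<psi>_integrable, of "2 ^ l" "- of_int k"]
  by (intro integrable_mult_right) simp

lemma scaling_coeff_linear:
  assumes "bounded_continuous f" "bounded_continuous g"
  shows "scaling_coeff \<phi> k (\<lambda>x. f x + c * g x) = scaling_coeff \<phi> k f + c * scaling_coeff \<phi> k g"
  unfolding scaling_coeff_def
  by (rule bounded_continuous_integral_linear[OF assms integrable_lebesgue_shift[OF \<phi>_integrable]])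

lemma wavelet_coeff_linear:
  assumes "bounded_continuous f" "bounded_continuous g"
  shows "wavelet_coeff \<psi> l k (\<lambda>x. f x + c * g x) = wavelet_coeff \<psi> l k f + c * wavelet_coeff \<psi> l k g"
  unfolding wavelet_coeff_def
  by (rule bounded_continuous_integral_linear[OF assms wavelet_integrable])

text \<open>
  Replacing \<open>f(x)\<close> by \<open>f(2\<^bsup>-j\<^esup> x)\<close> reduces the claim to level \<open>0\<close>; the scaling factors combine to
  \<open>2\<^bsup>j/2\<^esup>\<close>.
\<close>

lemma wavelet_coeff_le_approximation_error:
  assumes f: "bounded_continuous f" and S: "\<And>y. \<bar>proj \<phi> j f y - f y\<bar> \<le> S"
  shows "2 powr (real j / 2) * \<bar>wavelet_coeff \<psi> j 0 f\<bar> \<le> S * (LINT x|lebesgue. \<bar>\<psi> x\<bar>)"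
proof -
  define F where "F x = f (x / 2 ^ j)" for x
  obtain A where A: "\<And>x. \<bar>f x\<bar> \<le> A" using f by (auto simp: bounded_iff)
  have "continuous_on UNIV F"
    unfolding F_def[abs_def]
    by (rule continuous_on_compose2[of UNIV f]) (use f in \<open>auto intro!: continuous_intros\<close>)
  then have Fm: "F \<in> borel_measurable lebesgue"
    by (intro measurable_completion) (auto intro: borel_measurable_continuous_onI)
  have FA: "\<bar>F x\<bar> \<le> A" for x by (simp add: F_def A)
  have proj: "proj \<phi> j f y = (LINT x|lebesgue. proj_kernel \<phi> (2 ^ j * y) x * F x)" for y
    using lebesgue_integral_real_affine[of "2 ^ j" "\<lambda>x. proj_kernel \<phi> (2 ^ j * y) x * F x" 0]
    by (simp add: proj_def F_def mult.assoc)
  have "\<bar>(LINT x|lebesgue. proj_kernel \<phi> z x * F x) - F z\<bar> \<le> S" for z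
    using S[of "z / 2 ^ j"] by (simp add: proj F_def)
  moreover have "(LINT y|lebesgue. \<psi> y * \<phi> (y - of_int m)) = 0" for m :: int
    using scaling_wavelet_orthogonal[OF mra mw, of 0 0 m] by (simp add: l2_inner_def)
  ultimately have "\<bar>LINT x|lebesgue. F x * \<psi> x\<bar> \<le> S * (LINT x|lebesgue. \<bar>\<psi> x\<bar>)"
    using orthogonal_integral_le_approximation_error[OF \<phi>_integrable \<phi>_periodization \<psi>_integrable _ Fm FA]
    by blast
  moreover have "(LINT x|lebesgue. F x * \<psi> x) = 2 powr (real j / 2) * wavelet_coeff \<psi> j 0 f"
  proof -
    define J where "J = (LINT x|lebesgue. f x * \<psi> (2 ^ j * x))"
    have "(LINT x|lebesgue. F x * \<psi> x) = 2 ^ j * J"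
      using lebesgue_integral_real_affine[of "2 ^ j" "\<lambda>x. F x * \<psi> x" 0] by (simp add: F_def J_def)
    moreover have "wavelet_coeff \<psi> j 0 f = 2 powr (real j / 2) * J"
    proof -
      have "wavelet_coeff \<psi> j 0 f = (LINT x|lebesgue. 2 powr (real j / 2) * (f x * \<psi> (2 ^ j * x)))"
        unfolding wavelet_coeff_def by (intro Bochner_Integration.integral_cong) auto
      then show ?thesis by (simp add: J_def)
    qed
    moreover have "(2::real) ^ j = 2 powr (real j / 2) * 2 powr (real j / 2)"
      by (simp add: powr_add[symmetric] powr_realpow)
    ultimately show ?thesis by simp
  qed
  ultimately show ?thesis by (simp add: abs_mult)
qed

text \<open>
  Adding \<open>1\<close> to the integral makes the denominator positive without computing \<open>\<parallel>\<psi>\<parallel>\<^sub>1\<close>.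
\<close>

lemma sup_norm_approximation_error_ge:
  assumes f: "bounded_continuous f"
  shows "ereal (2 powr (real j / 2) * \<bar>wavelet_coeff \<psi> j 0 f\<bar> / ((LINT x|lebesgue. \<bar>\<psi> x\<bar>) + 1))
    \<le> sup_norm (\<lambda>y. proj \<phi> j f y - f y)"
proof (cases "sup_norm (\<lambda>y. proj \<phi> j f y - f y) = \<infinity>")
  case False
  let ?I = "LINT x|lebesgue. \<bar>\<psi> x\<bar>"
  have le: "ereal \<bar>proj \<phi> j f y - f y\<bar> \<le> sup_norm (\<lambda>y. proj \<phi> j f y - f y)" for y
    unfolding sup_norm_def by (rule SUP_upper) simp
  then have "0 \<le> sup_norm (\<lambda>y. proj \<phi> j f y - f y)"
    using order_trans[of 0 "ereal \<bar>proj \<phi> j f 0 - f 0\<bar>"] by simp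
  then obtain S where S: "sup_norm (\<lambda>y. proj \<phi> j f y - f y) = ereal S" "S \<ge> 0"
    using False by (cases "sup_norm (\<lambda>y. proj \<phi> j f y - f y)") auto
  have "?I \<ge> 0" by simp
  then have I: "?I + 1 > 0" by linarith
  have "2 powr (real j / 2) * \<bar>wavelet_coeff \<psi> j 0 f\<bar> \<le> S * ?I"
    using le unfolding S by (intro wavelet_coeff_le_approximation_error[OF f]) simp
  also have "\<dots> \<le> S * (?I + 1)" using S by (intro mult_left_mono) auto
  finally show ?thesis unfolding S using I by (simp add: pos_divide_le_eq)
qed simp

text \<open>
  One wavelet per level, at position \<open>0\<close>.  The weights \<open>2\<^bsup>-mt\<^esup>\<close> are the largest for which the norm of the
  series stays bounded, and since \<open>t > 0\<close> they still make it converge uniformly.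
\<close>

definition lacunary :: "(nat \<Rightarrow> real) \<Rightarrow> real \<Rightarrow> real" where
  "lacunary \<sigma> x = (\<Sum>m. \<sigma> m * (2 powr - t) ^ m * u (2 ^ m * x))"

context
  fixes \<sigma> :: "nat \<Rightarrow> real"
  assumes \<sigma>: "\<And>m. \<bar>\<sigma> m\<bar> \<le> 1"
begin

lemma lacunary_ratio: "0 < 2 powr - t" "2 powr - t < (1::real)"
  using t_pos powr_less_mono[of "- t" 0 2] by auto

lemma lacunary_term_bound: "\<bar>\<sigma> m * (2 powr - t) ^ m * u x\<bar> \<le> B * (2 powr - t) ^ m"
proof -
  have "\<bar>\<sigma> m\<bar> * (2 powr - t) ^ m * \<bar>u x\<bar> \<le> 1 * (2 powr - t) ^ m * B"
    using \<sigma> u_bounded[of x] by (intro mult_mono mult_right_mono) auto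
  then show ?thesis by (simp add: abs_mult mult.commute)
qed

lemma summable_lacunary_bound: "summable (\<lambda>m. B * (2 powr - t) ^ m)"
  using lacunary_ratio by (intro summable_mult summable_geometric) simp

lemma lacunary_bounded_continuous: "bounded_continuous (lacunary \<sigma>)"
proof
  let ?s = "\<lambda>n x. \<Sum>m<n. \<sigma> m * (2 powr - t) ^ m * u (2 ^ m * x)"
  have lim: "uniform_limit UNIV ?s (lacunary \<sigma>) sequentially"
    unfolding lacunary_def[abs_def]
    using lacunary_term_bound by (intro Weierstrass_m_test[OF _ summable_lacunary_bound]) simp
  have "continuous_on UNIV (\<lambda>x. u (2 ^ m * x))" for m
    using u_continuous by (rule continuous_on_compose2) (auto intro!: continuous_intros)
  then have "continuous_on UNIV (?s n)" for n
    by (intro continuous_on_sum continuous_on_mult_left)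
  then show "continuous_on UNIV (lacunary \<sigma>)"
    by (intro uniform_limit_theorem[OF _ lim]) auto
  have "norm (lacunary \<sigma> x) \<le> (\<Sum>m. B * (2 powr - t) ^ m)" for x
    unfolding lacunary_def using lacunary_term_bound
    by (intro norm_suminf_le summable_lacunary_bound) simp
  then show "bounded (range (lacunary \<sigma>))"
    by (intro boundedI) auto
qed

text \<open>
  The series converges uniformly and \<open>w\<close> is integrable, so integration is termwise; under the integral
  \<open>u\<close> may be replaced by \<open>\<psi>\<close>.
\<close>

lemma lacunary_integral:
  assumes w: "integrable lebesgue w"
  shows "(LINT x|lebesgue. lacunary \<sigma> x * w x)
    = (\<Sum>m. \<sigma> m * (2 powr - t) ^ m * (LINT x|lebesgue. \<psi> (2 ^ m * x) * w x))"
proof -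
  define s where "s m x = \<sigma> m * (2 powr - t) ^ m * u (2 ^ m * x) * w x" for m x
  have um: "(\<lambda>x. u (2 ^ m * x)) \<in> borel_measurable lebesgue" for m
  proof -
    have "continuous_on UNIV (\<lambda>x. u (2 ^ m * x))"
      using u_continuous by (rule continuous_on_compose2) (auto intro!: continuous_intros)
    then show ?thesis by (intro measurable_completion) (auto intro: borel_measurable_continuous_onI)
  qed
  have uw: "integrable lebesgue (\<lambda>x. u (2 ^ m * x) * w x)" for m
    using integrable_mult_AE_bounded[OF w um[of m], of B] u_bounded by (simp add: mult.commute)
  have s_int: "integrable lebesgue (s m)" for m
    unfolding s_def[abs_def] mult.assoc using uw by (intro integrable_mult_right) (simp add: mult.assoc)
  have s_bound: "norm (s m x) \<le> B * (2 powr - t) ^ m * \<bar>w x\<bar>" for m x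
    using mult_right_mono[OF lacunary_term_bound[of m "2 ^ m * x"], of "\<bar>w x\<bar>"]
    by (simp add: s_def abs_mult)
  have "(LINT x|lebesgue. lacunary \<sigma> x * w x) = (LINT x|lebesgue. (\<Sum>m. s m x))"
  proof (rule Bochner_Integration.integral_cong)
    fix x
    have "summable (\<lambda>m. \<sigma> m * (2 powr - t) ^ m * u (2 ^ m * x))"
      using lacunary_term_bound by (intro summable_comparison_test'[OF summable_lacunary_bound]) simp
    then show "lacunary \<sigma> x * w x = (\<Sum>m. s m x)"
      unfolding lacunary_def s_def by (rule suminf_mult2)
  qed simp
  also have "\<dots> = (\<Sum>m. LINT x|lebesgue. s m x)"
  proof (rule integral_suminf[OF s_int])
    show "AE x in lebesgue. summable (\<lambda>m. norm (s m x))"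
      by (intro AE_I2 summable_comparison_test'[OF summable_mult2[OF summable_lacunary_bound]])
        (use s_bound in simp)
    show "summable (\<lambda>m. LINT x|lebesgue. norm (s m x))"
    proof (rule summable_comparison_test'[OF summable_mult2[OF summable_lacunary_bound, of "LINT x|lebesgue. \<bar>w x\<bar>"], of 0])
      fix m :: nat
      have "(LINT x|lebesgue. norm (s m x)) \<le> (LINT x|lebesgue. B * (2 powr - t) ^ m * \<bar>w x\<bar>)"
        using s_int s_bound w
        by (intro integral_mono integrable_mult_right integrable_abs integrable_norm) auto
      then show "norm (LINT x|lebesgue. norm (s m x)) \<le> B * (2 powr - t) ^ m * (LINT x|lebesgue. \<bar>w x\<bar>)"
        by simp
    qed
  qed
  also have "\<dots> = (\<Sum>m. \<sigma> m * (2 powr - t) ^ m * (LINT x|lebesgue. \<psi> (2 ^ m * x) * w x))"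
  proof (rule suminf_cong)
    fix m
    have "AE x in lebesgue. u (2 ^ m * x) = \<psi> (2 ^ m * x)"
      using AE_lebesgue_affine[OF u_\<psi>, of "2 ^ m" 0] by simp
    then have ae: "AE x in lebesgue. u (2 ^ m * x) * w x = \<psi> (2 ^ m * x) * w x"
      by eventually_elim simp
    have "(LINT x|lebesgue. u (2 ^ m * x) * w x) = (LINT x|lebesgue. \<psi> (2 ^ m * x) * w x)"
      using borel_measurable_AE[OF borel_measurable_integrable[OF uw] ae] uw ae
      by (intro integral_cong_AE) auto
    then show "(LINT x|lebesgue. s m x) = \<sigma> m * (2 powr - t) ^ m * (LINT x|lebesgue. \<psi> (2 ^ m * x) * w x)"
      by (simp add: s_def mult.assoc)
  qed
  finally show ?thesis .
qed

lemma scaling_coeff_lacunary: "scaling_coeff \<phi> k (lacunary \<sigma>) = 0"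
proof -
  have "(LINT x|lebesgue. \<psi> (2 ^ m * x) * \<phi> (x - of_int k)) = 0" for m
    using scaling_wavelet_orthogonal[OF mra mw, of m 0 k] by (simp add: l2_inner_def)
  then show ?thesis
    unfolding scaling_coeff_def
    by (simp add: lacunary_integral[OF integrable_lebesgue_shift[OF \<phi>_integrable]])
qed

lemma wavelet_coeff_lacunary:
  "2 powr (real l * (t + 1 / 2)) * wavelet_coeff \<psi> l k (lacunary \<sigma>) = (if k = 0 then \<sigma> l else 0)"
proof -
  have ip: "(LINT x|lebesgue. \<psi> (2 ^ m * x) * (2 powr (real l / 2) * \<psi> (2 ^ l * x - of_int k)))
      = (if m = l \<and> k = 0 then 2 powr (real l / 2) / 2 ^ l else 0)" for m
  proof -
    have "(LINT x|lebesgue. \<psi> (2 ^ m * x) * (2 powr (real l / 2) * \<psi> (2 ^ l * x - of_int k)))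
        = (LINT x|lebesgue. 2 powr (real l / 2) * (\<psi> (2 ^ m * x) * \<psi> (2 ^ l * x - of_int k)))"
      by (intro Bochner_Integration.integral_cong) auto
    then show ?thesis
      using wavelets_orthogonal[OF mra mw, of m 0 l k] by (auto simp: l2_inner_def)
  qed
  have "wavelet_coeff \<psi> l k (lacunary \<sigma>)
      = (\<Sum>m. \<sigma> m * (2 powr - t) ^ m * (if m = l \<and> k = 0 then 2 powr (real l / 2) / 2 ^ l else 0))"
    unfolding wavelet_coeff_def lacunary_integral[OF wavelet_integrable] ip ..
  also have "\<dots> = (\<Sum>m. if m = l then \<sigma> m * (2 powr - t) ^ m * (if k = 0 then 2 powr (real l / 2) / 2 ^ l else 0) else 0)"
    by (intro suminf_cong) auto
  also have "\<dots> = \<sigma> l * (2 powr - t) ^ l * (if k = 0 then 2 powr (real l / 2) / 2 ^ l else 0)"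
    by (rule sums_unique[OF sums_single, symmetric])
  finally have wc: "wavelet_coeff \<psi> l k (lacunary \<sigma>)
      = \<sigma> l * (2 powr - t) ^ l * (if k = 0 then 2 powr (real l / 2) / 2 ^ l else 0)" .
  have "2 powr (real l * (t + 1 / 2)) * ((2 powr - t) ^ l * (2 powr (real l / 2) / 2 ^ l)) = (1::real)"
  proof -
    have "(2 powr - t) ^ l = 2 powr (- t * real l)"
      by (simp add: powr_power mult.commute)
    moreover have "(2::real) ^ l = 2 powr real l" by (simp add: powr_realpow)
    ultimately have "2 powr (real l * (t + 1 / 2)) * ((2 powr - t) ^ l * (2 powr (real l / 2) / 2 ^ l))
       = 2 powr (real l * (t + 1 / 2) + (- t * real l + (real l / 2 - real l)))"
      by (simp only: powr_add powr_diff)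
    also have "real l * (t + 1 / 2) + (- t * real l + (real l / 2 - real l)) = 0"
      by (simp add: algebra_simps)
    finally show ?thesis by simp
  qed
  then show ?thesis unfolding wc by (simp add: mult_ac)
qed

end

section \<open>Balls in the Hoelder--Zygmund space\<close>

abbreviation hz_ball :: "(real \<Rightarrow> real) \<Rightarrow> real \<Rightarrow> (real \<Rightarrow> real) set" where
  "hz_ball f e \<equiv> {g \<in> hz_space \<phi> \<psi> t. hz_norm \<phi> \<psi> t (\<lambda>x. g x - f x) < ereal e}"

lemma hz_norm_leI:
  assumes "\<And>k. ereal \<bar>scaling_coeff \<phi> k f\<bar> \<le> a"
    and "\<And>l k. ereal (2 powr (real l * (t + 1 / 2)) * \<bar>wavelet_coeff \<psi> l k f\<bar>) \<le> b"
  shows "hz_norm \<phi> \<psi> t f \<le> a + b"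
  unfolding hz_norm_def using assms by (intro add_mono SUP_least) auto

lemma scaling_sup_nonneg: "0 \<le> (SUP k. ereal \<bar>scaling_coeff \<phi> k f\<bar>)"
  by (rule SUP_upper2[of 0]) auto

lemma wavelet_sup_upper:
  "ereal (2 powr (real l * (t + 1 / 2)) * \<bar>wavelet_coeff \<psi> l k f\<bar>)
    \<le> (SUP l. SUP k. ereal (2 powr (real l * (t + 1/2)) * \<bar>wavelet_coeff \<psi> l k f\<bar>))"
  by (rule SUP_upper2[of l], simp, rule SUP_upper) simp

lemma wavelet_coeff_le_hz_norm:
  "ereal (2 powr (real l * (t + 1 / 2)) * \<bar>wavelet_coeff \<psi> l k f\<bar>) \<le> hz_norm \<phi> \<psi> t f"
  unfolding hz_norm_def
  using add_mono[OF scaling_sup_nonneg wavelet_sup_upper[of l k f]] by simp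

lemma hz_norm_nonneg: "0 \<le> hz_norm \<phi> \<psi> t f"
  by (rule order_trans[OF _ wavelet_coeff_le_hz_norm[of 0 0]]) simp

lemma hz_norm_triangle:
  assumes f: "bounded_continuous f" and g: "bounded_continuous g"
  shows "hz_norm \<phi> \<psi> t (\<lambda>x. f x + g x) \<le> hz_norm \<phi> \<psi> t f + hz_norm \<phi> \<psi> t g"
proof -
  let ?a = "\<lambda>f. SUP k. ereal \<bar>scaling_coeff \<phi> k f\<bar>"
  let ?b = "\<lambda>f. SUP l. SUP k. ereal (2 powr (real l * (t + 1/2)) * \<bar>wavelet_coeff \<psi> l k f\<bar>)"
  have "hz_norm \<phi> \<psi> t (\<lambda>x. f x + g x) \<le> (?a f + ?a g) + (?b f + ?b g)"
  proof (rule hz_norm_leI)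
    fix k
    have "ereal \<bar>scaling_coeff \<phi> k (\<lambda>x. f x + g x)\<bar> \<le> ereal \<bar>scaling_coeff \<phi> k f\<bar> + ereal \<bar>scaling_coeff \<phi> k g\<bar>"
      using scaling_coeff_linear[OF f g, of k 1] by simp
    also have "\<dots> \<le> ?a f + ?a g"
      by (intro add_mono SUP_upper) auto
    finally show "ereal \<bar>scaling_coeff \<phi> k (\<lambda>x. f x + g x)\<bar> \<le> ?a f + ?a g" .
  next
    fix l k
    let ?c = "2 powr (real l * (t + 1 / 2))"
    have "?c * \<bar>wavelet_coeff \<psi> l k (\<lambda>x. f x + g x)\<bar>
        \<le> ?c * (\<bar>wavelet_coeff \<psi> l k f\<bar> + \<bar>wavelet_coeff \<psi> l k g\<bar>)"
      using wavelet_coeff_linear[OF f g, of l k 1] by (intro mult_left_mono) auto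
    then have "ereal (?c * \<bar>wavelet_coeff \<psi> l k (\<lambda>x. f x + g x)\<bar>)
        \<le> ereal (?c * \<bar>wavelet_coeff \<psi> l k f\<bar>) + ereal (?c * \<bar>wavelet_coeff \<psi> l k g\<bar>)"
      by (simp add: distrib_left)
    also have "\<dots> \<le> ?b f + ?b g"
      by (intro add_mono wavelet_sup_upper)
    finally show "ereal (?c * \<bar>wavelet_coeff \<psi> l k (\<lambda>x. f x + g x)\<bar>) \<le> ?b f + ?b g" .
  qed
  then show ?thesis
    by (simp add: hz_norm_def add_ac)
qed

lemma hz_norm_lacunary_le:
  assumes "\<And>m. \<bar>\<sigma> m\<bar> \<le> 1"
  shows "hz_norm \<phi> \<psi> t (\<lambda>x. c * lacunary \<sigma> x) \<le> ereal \<bar>c\<bar>"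
proof -
  have zero: "bounded_continuous (\<lambda>x. 0)"
    by auto
  note bc = lacunary_bounded_continuous[of \<sigma>, OF assms]
  have "hz_norm \<phi> \<psi> t (\<lambda>x. c * lacunary \<sigma> x) \<le> 0 + ereal \<bar>c\<bar>"
  proof (rule hz_norm_leI)
    show "ereal \<bar>scaling_coeff \<phi> k (\<lambda>x. c * lacunary \<sigma> x)\<bar> \<le> 0" for k
      using scaling_coeff_linear[OF zero bc, of k c] scaling_coeff_lacunary[of \<sigma>, OF assms]
      by (simp add: scaling_coeff_def)
    fix l k
    let ?c = "2 powr (real l * (t + 1 / 2))"
    have "wavelet_coeff \<psi> l k (\<lambda>x. c * lacunary \<sigma> x) = c * wavelet_coeff \<psi> l k (lacunary \<sigma>)"
      using wavelet_coeff_linear[OF zero bc, of l k c] by (simp add: wavelet_coeff_def)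
    then have "?c * \<bar>wavelet_coeff \<psi> l k (\<lambda>x. c * lacunary \<sigma> x)\<bar>
        = \<bar>c\<bar> * \<bar>?c * wavelet_coeff \<psi> l k (lacunary \<sigma>)\<bar>"
      by (simp add: abs_mult mult_ac)
    also have "\<dots> \<le> \<bar>c\<bar> * 1"
      using assms unfolding wavelet_coeff_lacunary[of \<sigma>, OF assms] by (intro mult_left_mono) auto
    finally show "ereal (?c * \<bar>wavelet_coeff \<psi> l k (\<lambda>x. c * lacunary \<sigma> x)\<bar>) \<le> ereal \<bar>c\<bar>"
      by simp
  qed
  then show ?thesis by simp
qed

lemma hz_ball_centre: "f \<in> hz_space \<phi> \<psi> t \<Longrightarrow> e > 0 \<Longrightarrow> f \<in> hz_ball f e"
  using hz_norm_leI[of "\<lambda>x. 0" 0 0]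
  by (simp add: scaling_coeff_def wavelet_coeff_def order_le_less_trans[of _ 0])

lemma hz_ball_open: "f \<in> hz_space \<phi> \<psi> t \<Longrightarrow> e > 0 \<Longrightarrow> openin (hz_topology \<phi> \<psi> t) (hz_ball f e)"
  unfolding hz_topology_def by (rule topology_generated_by_Basis) blast

lemma hz_ball_inside_ball:
  assumes f: "f \<in> hz_ball f0 e0" and f0: "f0 \<in> hz_space \<phi> \<psi> t"
  shows "\<exists>e>0. hz_ball f e \<subseteq> hz_ball f0 e0"
proof -
  have bc: "bounded_continuous p" if "p \<in> hz_space \<phi> \<psi> t" for p
    using that by (simp add: hz_space_def)
  have bcd: "bounded_continuous (\<lambda>x. p x - q x)" if "p \<in> hz_space \<phi> \<psi> t" "q \<in> hz_space \<phi> \<psi> t" for p q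
    using bounded_continuous_add_mult[of p q "- 1"] that bc by simp
  have fin: "hz_norm \<phi> \<psi> t (\<lambda>x. f x - f0 x) < ereal e0" using f by simp
  obtain r where r: "hz_norm \<phi> \<psi> t (\<lambda>x. f x - f0 x) = ereal r"
    using fin hz_norm_nonneg[of "\<lambda>x. f x - f0 x"]
    by (cases "hz_norm \<phi> \<psi> t (\<lambda>x. f x - f0 x)") auto
  have "hz_ball f (e0 - r) \<subseteq> hz_ball f0 e0"
  proof
    fix g assume "g \<in> hz_ball f (e0 - r)"
    then have g: "g \<in> hz_space \<phi> \<psi> t" "hz_norm \<phi> \<psi> t (\<lambda>x. g x - f x) < ereal (e0 - r)"
      by auto
    have fs: "f \<in> hz_space \<phi> \<psi> t" using f by simp
    have "hz_norm \<phi> \<psi> t (\<lambda>x. g x - f0 x) \<le> hz_norm \<phi> \<psi> t (\<lambda>x. g x - f x) + ereal r"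
      using hz_norm_triangle[OF bcd[OF g(1) fs] bcd[OF fs f0]] r by simp
    also have "\<dots> < ereal e0"
      using g(2) by (cases "hz_norm \<phi> \<psi> t (\<lambda>x. g x - f x)") auto
    finally show "g \<in> hz_ball f0 e0"
      using g(1) by simp
  qed
  moreover have "e0 - r > 0" using fin r by simp
  ultimately show ?thesis by blast
qed

text \<open>
  The balls are only a subbase by definition.  The triangle inequality makes them a base: a point of a
  ball is the centre of a smaller ball inside it, and the balls around a point are nested.
\<close>

lemma hz_open_contains_ball:
  assumes "openin (hz_topology \<phi> \<psi> t) U" "f \<in> U"
  shows "f \<in> hz_space \<phi> \<psi> t" "\<exists>e>0. hz_ball f e \<subseteq> U"
proof -
  have "generate_topology_on {hz_ball f e |f e. f \<in> hz_space \<phi> \<psi> t \<and> e > 0} U"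
    using assms(1) unfolding hz_topology_def openin_topology_generated_by_iff .
  then have "f \<in> hz_space \<phi> \<psi> t \<and> (\<exists>e>0. hz_ball f e \<subseteq> U)"
    using assms(2)
  proof (induction arbitrary: f)
    case Empty
    then show ?case by simp
  next
    case (Int a b)
    then obtain d e where "d > 0" "hz_ball f d \<subseteq> a" "e > 0" "hz_ball f e \<subseteq> b" "f \<in> hz_space \<phi> \<psi> t"
      by blast
    moreover have "hz_ball f (min d e) \<subseteq> hz_ball f d" "hz_ball f (min d e) \<subseteq> hz_ball f e"
      by (auto elim!: order_less_le_trans)
    ultimately show ?case
      by (intro conjI exI[of _ "min d e"]) auto
  next
    case (UN K)
    then obtain k where "k \<in> K" "f \<in> k" by blast
    then show ?case using UN.IH by blast
  next
    case (Basis s)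
    then show ?case using hz_ball_inside_ball by auto
  qed
  then show "f \<in> hz_space \<phi> \<psi> t" "\<exists>e>0. hz_ball f e \<subseteq> U" by auto
qed

section \<open>Slow approximation is generic\<close>

definition slow_approximation :: "(real \<Rightarrow> real) \<Rightarrow> bool" where
  "slow_approximation f \<longleftrightarrow> (\<exists>b\<^sub>1>0. \<exists>j\<^sub>0::nat. \<forall>j\<ge>j\<^sub>0.
     sup_norm (\<lambda>y. proj \<phi> j f y - f y) \<ge> ereal (b\<^sub>1 * 2 powr (- (real j * t))))"

text \<open>
  The factor \<open>2\<^bsup>j/2\<^esup>\<close> in the lower bound for the projection error accounts for half of the normalisation
  \<open>2\<^bsup>j(t+1/2)\<^esup>\<close>; what is left is the rate \<open>2\<^bsup>-jt\<^esup>\<close>.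
\<close>

lemma slow_approximationI:
  assumes f: "bounded_continuous f" and d: "d > 0"
    and big: "\<And>l. d \<le> 2 powr (real l * (t + 1 / 2)) * \<bar>wavelet_coeff \<psi> l 0 f\<bar>"
  shows "slow_approximation f"
proof -
  define I where "I = (LINT x|lebesgue. \<bar>\<psi> x\<bar>) + 1"
  have "(LINT x|lebesgue. \<bar>\<psi> x\<bar>) \<ge> 0" by simp
  then have I: "I > 0" unfolding I_def by linarith
  have "ereal (d / I * 2 powr (- (real j * t))) \<le> sup_norm (\<lambda>y. proj \<phi> j f y - f y)" for j
  proof -
    have "d * 2 powr (- (real j * t))
        \<le> 2 powr (real j * (t + 1 / 2)) * \<bar>wavelet_coeff \<psi> j 0 f\<bar> * 2 powr (- (real j * t))"
      by (intro mult_right_mono big) simp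
    also have "\<dots> = 2 powr (real j * (t + 1 / 2) + - (real j * t)) * \<bar>wavelet_coeff \<psi> j 0 f\<bar>"
      by (simp only: powr_add mult_ac)
    also have "real j * (t + 1 / 2) + - (real j * t) = real j / 2"
      by (simp add: algebra_simps)
    finally have "d / I * 2 powr (- (real j * t)) \<le> 2 powr (real j / 2) * \<bar>wavelet_coeff \<psi> j 0 f\<bar> / I"
      using I by (simp add: divide_right_mono)
    then show ?thesis
      using sup_norm_approximation_error_ge[OF f, of j] order_trans unfolding I_def[symmetric]
      by (metis ereal_less_eq(3))
  qed
  then show ?thesis
    unfolding slow_approximation_def using d I by (intro exI[of _ "d / I"]) auto
qed

text \<open>
  The new centre is \<open>f + (e/2) h\<close>, with the signs in \<open>h\<close> aligned to those of the coefficients of \<open>f\<close>.  Its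
  normalised coefficients at \<open>k = 0\<close> are at least \<open>e/2\<close> in modulus, and a perturbation of norm less than
  \<open>e/4\<close> leaves at least \<open>e/4\<close> of them.
\<close>

lemma hz_ball_contains_slow_ball:
  assumes f: "f \<in> hz_space \<phi> \<psi> t" and e: "e > 0"
  obtains g where "g \<in> hz_ball f e" "\<And>p. p \<in> hz_ball g (e / 4) \<Longrightarrow> slow_approximation p"
proof -
  define \<sigma> where "\<sigma> l = (if wavelet_coeff \<psi> l 0 f \<ge> 0 then 1 else - 1 :: real)" for l
  have \<sigma>: "\<bar>\<sigma> m\<bar> \<le> 1" for m by (simp add: \<sigma>_def)
  note h = lacunary_bounded_continuous[of \<sigma>, OF \<sigma>]
  define g where "g x = f x + e / 2 * lacunary \<sigma> x" for x
  have fb: "bounded_continuous f" "hz_norm \<phi> \<psi> t f < \<infinity>"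
    using f by (auto simp: hz_space_def)
  have gb: "bounded_continuous g"
    unfolding g_def[abs_def] by (rule bounded_continuous_add_mult[OF fb(1) h])
  have hn: "hz_norm \<phi> \<psi> t (\<lambda>x. e / 2 * lacunary \<sigma> x) \<le> ereal (e / 2)"
    using hz_norm_lacunary_le[of \<sigma> "e / 2", OF \<sigma>] e by simp
  have hb: "bounded_continuous (\<lambda>x. e / 2 * lacunary \<sigma> x)"
    using bounded_continuous_add_mult[of "\<lambda>x. 0", OF _ h, of "e / 2"] by auto
  have "hz_norm \<phi> \<psi> t g \<le> hz_norm \<phi> \<psi> t f + ereal (e / 2)"
    unfolding g_def[abs_def] using hz_norm_triangle[OF fb(1) hb] hn
    by (meson add_left_mono order_trans)
  also have "\<dots> < \<infinity>" using fb(2) by simp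
  finally have gs: "g \<in> hz_space \<phi> \<psi> t" using gb by (simp add: hz_space_def)
  have "hz_norm \<phi> \<psi> t (\<lambda>x. g x - f x) \<le> ereal (e / 2)"
    using hn by (simp add: g_def)
  also have "\<dots> < ereal e" using e by simp
  finally have gf: "g \<in> hz_ball f e" using gs by simp
  \<comment> \<open>Values of the same sign add up without cancellation, even when the coefficient \<open>a\<close> vanishes.\<close>
  have same_sign: "e / 2 \<le> \<bar>b\<bar>" if "b = a + e / 2 * s" "0 \<le> a \<longleftrightarrow> s = 1" "s = 1 \<or> s = - 1" for a b s :: real
    using that(3,1,2) e by (elim disjE) auto
  have "slow_approximation p" if p: "p \<in> hz_ball g (e / 4)" for p
  proof (rule slow_approximationI)
    show pb: "bounded_continuous p" using p by (simp add: hz_space_def)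
    show "e / 4 > 0" using e by simp
    fix l
    let ?c = "2 powr (real l * (t + 1 / 2))"
    have "ereal (?c * \<bar>wavelet_coeff \<psi> l 0 (\<lambda>x. p x - g x)\<bar>) < ereal (e / 4)"
      by (rule order_le_less_trans[OF wavelet_coeff_le_hz_norm]) (use p in simp)
    moreover have "wavelet_coeff \<psi> l 0 (\<lambda>x. p x - g x) = wavelet_coeff \<psi> l 0 p - wavelet_coeff \<psi> l 0 g"
      using wavelet_coeff_linear[OF pb gb, of l 0 "- 1"] by simp
    ultimately have pg: "\<bar>?c * wavelet_coeff \<psi> l 0 p - ?c * wavelet_coeff \<psi> l 0 g\<bar> < e / 4"
      unfolding right_diff_distrib[symmetric] abs_mult by simp
    have "?c * wavelet_coeff \<psi> l 0 g = ?c * wavelet_coeff \<psi> l 0 f + e / 2 * \<sigma> l"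
      using wavelet_coeff_linear[OF fb(1) h, of l 0 "e / 2"] wavelet_coeff_lacunary[of \<sigma> l 0, OF \<sigma>]
      by (simp add: g_def[abs_def] distrib_left mult.left_commute)
    moreover have "?c * wavelet_coeff \<psi> l 0 f \<ge> 0 \<longleftrightarrow> \<sigma> l = 1" "\<sigma> l = 1 \<or> \<sigma> l = - 1"
      by (auto simp: \<sigma>_def zero_le_mult_iff)
    ultimately have "e / 2 \<le> \<bar>?c * wavelet_coeff \<psi> l 0 g\<bar>"
      by (rule same_sign)
    then have "e / 4 \<le> \<bar>?c * wavelet_coeff \<psi> l 0 p\<bar>"
      using pg by linarith
    then show "e / 4 \<le> ?c * \<bar>wavelet_coeff \<psi> l 0 p\<bar>" by (simp add: abs_mult)
  qed
  with gf show thesis by (rule that)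
qed

lemma fast_approximation_nowhere_dense:
  "nowhere_dense_in (hz_topology \<phi> \<psi> t) {f \<in> hz_space \<phi> \<psi> t. \<not> slow_approximation f}"
  (is "nowhere_dense_in ?X ?N")
  unfolding nowhere_dense_in_def
proof (rule ccontr)
  assume "?X interior_of (?X closure_of ?N) \<noteq> {}"
  then obtain f U where U: "openin ?X U" "f \<in> U" "U \<subseteq> ?X closure_of ?N"
    unfolding interior_of_def by blast
  obtain e where e: "e > 0" "hz_ball f e \<subseteq> U"
    using hz_open_contains_ball(2)[OF U(1,2)] by blast
  obtain g where g: "g \<in> hz_ball f e" "\<And>p. p \<in> hz_ball g (e / 4) \<Longrightarrow> slow_approximation p"
    using hz_ball_contains_slow_ball[OF hz_open_contains_ball(1)[OF U(1,2)] e(1)] by blast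
  have gs: "g \<in> hz_space \<phi> \<psi> t" using g(1) by simp
  have e4: "e / 4 > 0" using e(1) by simp
  have "g \<in> ?X closure_of ?N" using g(1) e(2) U(3) by blast
  then have "\<forall>T. g \<in> T \<and> openin ?X T \<longrightarrow> (\<exists>p. p \<in> ?N \<and> p \<in> T)"
    unfolding in_closure_of by (rule conjunct2)
  then obtain p where p: "p \<in> ?N" "p \<in> hz_ball g (e / 4)"
    using hz_ball_centre[OF gs e4] hz_ball_open[OF gs e4] by meson
  from p(1) g(2)[OF p(2)] show False by simp
qed

end

section \<open>Regular functions\<close>

lemma regularE:
  assumes "regular s f"
  obtains D c b q where "D 0 = f" "c > 0" "b > 0" "0 < q" "q < 1"
    "\<forall>\<alpha>\<le>s. weak_derivative \<alpha> f (D \<alpha>)"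
    "\<forall>\<alpha>\<le>s. AE x in lebesgue. \<bar>D \<alpha> x\<bar> \<le> c * q powr (b * \<bar>x\<bar>)"
proof -
  from assms obtain D c b q where "D 0 = f" "c > 0" "b > 0" "0 < q" "q < 1" and
    *: "\<forall>\<alpha>\<le>s. weak_derivative \<alpha> f (D \<alpha>) \<and> (AE x in lebesgue. \<bar>D \<alpha> x\<bar> \<le> c * q powr (b * \<bar>x\<bar>))"
    unfolding regular_def by (elim exE conjE)
  then show thesis
    by (intro that[of D c b q]) simp_all
qed

lemma regular_integrable:
  assumes "regular s f" "f \<in> L2"
  shows "integrable lebesgue f"
proof -
  obtain D c b q where D: "D 0 = f" "c > 0" "b > 0" "0 < q" "q < 1"
    "\<forall>\<alpha>\<le>s. weak_derivative \<alpha> f (D \<alpha>)"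
    "\<forall>\<alpha>\<le>s. AE x in lebesgue. \<bar>D \<alpha> x\<bar> \<le> c * q powr (b * \<bar>x\<bar>)"
    by (rule regularE[OF assms(1)])
  show ?thesis
    using assms(2) D(7)[rule_format, of 0] D(1) by (intro exponential_decay_integrable[OF _ D(4,5,3)]) (auto simp: L2_def)
qed

lemma regular_periodization:
  assumes "regular s f"
  obtains C where "AE x in lebesgue. \<forall>F::int set. finite F \<longrightarrow> (\<Sum>m\<in>F. \<bar>f (x - of_int m)\<bar>) \<le> C"
proof -
  obtain D c b q where D: "D 0 = f" "c > 0" "b > 0" "0 < q" "q < 1"
    "\<forall>\<alpha>\<le>s. weak_derivative \<alpha> f (D \<alpha>)"
    "\<forall>\<alpha>\<le>s. AE x in lebesgue. \<bar>D \<alpha> x\<bar> \<le> c * q powr (b * \<bar>x\<bar>)"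
    by (rule regularE[OF assms])
  show thesis
    using exponential_decay_periodization[OF D(4,5,3,2) D(7)[rule_format, of 0]] D(1) that by auto
qed

lemma regular_continuous_representative:
  assumes reg: "regular s f" and s: "1 \<le> s" and L2: "f \<in> L2"
  obtains u B where "continuous_on UNIV u" "\<forall>x. \<bar>u x\<bar> \<le> B" "AE x in lebesgue. u x = f x"
proof -
  obtain D c b q where D: "D 0 = f" "c > 0" "b > 0" "0 < q" "q < 1"
    "\<forall>\<alpha>\<le>s. weak_derivative \<alpha> f (D \<alpha>)"
    "\<forall>\<alpha>\<le>s. AE x in lebesgue. \<bar>D \<alpha> x\<bar> \<le> c * q powr (b * \<bar>x\<bar>)"
    by (rule regularE[OF reg])
  have le: "c * q powr (b * \<bar>x\<bar>) \<le> c" for x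
  proof -
    have "q powr (b * \<bar>x\<bar>) \<le> q powr 0"
      using D(3,4,5) by (intro powr_mono') auto
    then show ?thesis using D(2,4) by simp
  qed
  have bound: "AE x in lebesgue. \<bar>D \<alpha> x\<bar> \<le> c" if "\<alpha> \<le> s" for \<alpha>
    using D(7)[rule_format, OF that] by eventually_elim (rule order_trans[OF _ le])
  show thesis
    using continuous_representative[OF regular_integrable[OF reg L2] D(6)[rule_format, OF s] bound[OF s]
        bound[of 0, unfolded D(1)]] that by blast
qed

section \<open>Nowhere density of fast approximation\<close>

theorem proposition4:
  fixes r :: int and t :: real
    and V :: "int \<Rightarrow> (real \<Rightarrow> real) set"
    and \<phi> \<psi> :: "real \<Rightarrow> real"
  assumes "0 < t" and "t < real_of_int (r - 1)"
    and "multiresolution_analysis V \<phi>"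
    and "regular (nat (r - 1)) \<phi>"
    and "mother_wavelet V \<psi>"
    and "regular (nat (r - 1)) \<psi>"
  shows "nowhere_dense_in (hz_topology \<phi> \<psi> t)
    {f \<in> hz_space \<phi> \<psi> t.
       \<not> (\<exists>b\<^sub>1>0. \<exists>j\<^sub>0::nat. \<forall>j\<ge>j\<^sub>0.
            sup_norm (\<lambda>y. proj \<phi> j f y - f y) \<ge> ereal (b\<^sub>1 * 2 powr (- (real j * t))))}"
proof -
  have sub: "V j \<subseteq> L2" for j
    using assms(3) by (simp add: multiresolution_analysis_def l2_closed_subspace_def)
  have \<phi>: "\<phi> \<in> L2"
    using scaling_function_in_V0[OF assms(3), of 0] sub by auto
  have \<psi>: "\<psi> \<in> L2"
    using mother_wavelet_in_W0(1)[OF assms(5), where k = 0] sub by auto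
  \<comment> \<open>As \<open>0 < t < r - 1\<close> and \<open>r\<close> is an integer, \<open>r - 1\<close> is positive.\<close>
  have s: "1 \<le> nat (r - 1)" using assms(1,2) by linarith
  obtain C where C: "AE x in lebesgue. \<forall>F::int set. finite F \<longrightarrow> (\<Sum>m\<in>F. \<bar>\<phi> (x - of_int m)\<bar>) \<le> C"
    by (rule regular_periodization[OF assms(4)])
  obtain u B where u: "continuous_on UNIV u" "\<forall>x. \<bar>u x\<bar> \<le> B" "AE x in lebesgue. u x = \<psi> x"
    by (rule regular_continuous_representative[OF assms(6) s \<psi>])
  interpret wavelet_system V \<phi> \<psi> u B C t
    by (rule wavelet_system.intro)
      (rule assms(3) assms(5) regular_integrable[OF assms(4) \<phi>] regular_integrable[OF assms(6) \<psi>]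
        C u(1) u(2)[rule_format] u(3) assms(1))+
  show ?thesis
    using fast_approximation_nowhere_dense unfolding slow_approximation_def .
qed

end
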